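(* Let $(X,x_0)$ be a pointed space which is first countable at $x_0$ and locally strongly contractible at $x_0$. Then $$\mathcal{H}_\infty(X,x_0)\cong\prod^w_{n\in\mathbb{N}}\prod^w_{k\in\mathbb{N}}\pi_n(X,x_0).$$
   Context: For $n\geq1$, $\mathbb{H}^n=\{(r_0,\dots,r_n)\in\mathbb{R}^{n+1} : (r_0-1/k)^2+\sum_{i=1}^n r_i^2=(1/k)^2 \text{ for some } k\in\mathbb{N}\}$ is the $n$-dimensional Hawaiian earring with base point $\theta$ (the origin); $S^n_k$ is its sphere of radius $1/k$. The infinite dimensional Hawaiian earring $\mathbb{H}^\infty$ is the weak join of $\{(\mathbb{H}^n,\theta)\}_{n\in\mathbb{N}}$: the disjoint union with all base points identified to one point $\theta$, where $U$ is open iff $U\cap\mathbb{H}^n$ is open in $\mathbb{H}^n$ for all $n$ and, if $\theta\in U$, then $\mathbb{H}^n\subseteq U$ for all but finitely many $n$. $\mathcal{H}_\infty(X,x_0)$ is the set of pointed homotopy classes (rel $\{\theta\}$) of continuous maps $(\mathbb{H}^\infty,\theta)\to(X,x_0)$, with group operation $[f][g]=[f\ast g]$ where on each sphere $S^n_k\subseteq\mathbb{H}^n\subseteq\mathbb{H}^\infty$, $(f\ast g)|_{S^n_k}$ is the usual $\pi_n$-concatenation of $f|_{S^n_k}$ and $g|_{S^n_k}$. $X$ is locally strongly contractible at $x_0$ if for every neighborhood $U$ of $x_0$ there is a neighborhood $V\subseteq U$ of $x_0$ such that the inclusion $V\hookrightarrow U$ is homotopic in $U$ to the constant map at $x_0$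 relative to $\{x_0\}$. $\prod^w$ denotes the weak direct product (families with all but finitely many entries trivial). *)

theory Defs
  imports "HOL-Analysis.Analysis" "HOL-Algebra.Product_Groups"
begin

definition first_countable_at :: "'a topology \<Rightarrow> 'a \<Rightarrow> bool" where
  "first_countable_at X x0 \<longleftrightarrow>
     (\<exists>\<B>. countable \<B> \<and> (\<forall>V\<in>\<B>. openin X V \<and> x0 \<in> V) \<and>
          (\<forall>U. openin X U \<and> x0 \<in> U \<longrightarrow> (\<exists>V\<in>\<B>. V \<subseteq> U)))"

definition locally_strongly_contractible_at :: "'a topology \<Rightarrow> 'a \<Rightarrow> bool" where
  "locally_strongly_contractible_at X x0 \<longleftrightarrow>
     (\<forall>U. openin X U \<and> x0 \<in> U \<longrightarrow>
        (\<exists>V. openin X V \<and> x0 \<in> V \<and> V \<subseteq> U \<and>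
             homotopic_with (\<lambda>h. h x0 = x0) (subtopology X V) (subtopology X U) id (\<lambda>_. x0)))"

definition hclass :: "('b \<Rightarrow> 'a) set \<Rightarrow> (('b \<Rightarrow> 'a) \<Rightarrow> ('b \<Rightarrow> 'a) \<Rightarrow> bool) \<Rightarrow> ('b \<Rightarrow> 'a) \<Rightarrow> ('b \<Rightarrow> 'a) set" where
  "hclass M R f = {g \<in> M. R f g}"

definition hclass_group ::
  "('b \<Rightarrow> 'a) set \<Rightarrow> (('b \<Rightarrow> 'a) \<Rightarrow> ('b \<Rightarrow> 'a) \<Rightarrow> bool)
     \<Rightarrow> (('b \<Rightarrow> 'a) \<Rightarrow> ('b \<Rightarrow> 'a) \<Rightarrow> ('b \<Rightarrow> 'a)) \<Rightarrow> ('b \<Rightarrow> 'a) \<Rightarrow> ('b \<Rightarrow> 'a) set monoid" where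
  "hclass_group M R op e =
     \<lparr>carrier = hclass M R ` M,
      monoid.mult = (\<lambda>A B. hclass M R (op (SOME f. f \<in> A) (SOME g. g \<in> B))),
      one = hclass M R e\<rparr>"

definition cube_set :: "nat \<Rightarrow> (nat \<Rightarrow> real) set" where
  "cube_set n = {t. (\<forall>i<n. 0 \<le> t i \<and> t i \<le> 1) \<and> (\<forall>i\<ge>n. t i = 0)}"

definition cube :: "nat \<Rightarrow> (nat \<Rightarrow> real) topology" where
  "cube n = subtopology (Euclidean_space n) (cube_set n)"

definition cube_boundary :: "nat \<Rightarrow> (nat \<Rightarrow> real) set" where
  "cube_boundary n = {t \<in> cube_set n. \<exists>i<n. t i = 0 \<or> t i = 1}"

definition pi_maps :: "nat \<Rightarrow> 'a topology \<Rightarrow> 'a \<Rightarrow> ((nat \<Rightarrow> real) \<Rightarrow> 'a) set" where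
  "pi_maps n X x0 = {f. continuous_map (cube n) X f \<and> (\<forall>t\<in>cube_boundary n. f t = x0)}"

definition pi_rel :: "nat \<Rightarrow> 'a topology \<Rightarrow> 'a \<Rightarrow> ((nat \<Rightarrow> real) \<Rightarrow> 'a) \<Rightarrow> ((nat \<Rightarrow> real) \<Rightarrow> 'a) \<Rightarrow> bool" where
  "pi_rel n X x0 f g = homotopic_with (\<lambda>h. \<forall>t\<in>cube_boundary n. h t = x0) (cube n) X f g"

definition cube_concat :: "((nat \<Rightarrow> real) \<Rightarrow> 'a) \<Rightarrow> ((nat \<Rightarrow> real) \<Rightarrow> 'a) \<Rightarrow> (nat \<Rightarrow> real) \<Rightarrow> 'a" where
  "cube_concat f g t = (if t 0 \<le> 1/2 then f (t(0 := 2 * t 0)) else g (t(0 := 2 * t 0 - 1)))"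

definition pi_group :: "nat \<Rightarrow> 'a topology \<Rightarrow> 'a \<Rightarrow> ((nat \<Rightarrow> real) \<Rightarrow> 'a) set monoid" where
  "pi_group n X x0 = hclass_group (pi_maps n X x0) (pi_rel n X x0) cube_concat (\<lambda>_. x0)"

definition hsphere :: "nat \<Rightarrow> nat \<Rightarrow> (nat \<Rightarrow> real) set" where
  "hsphere n k = {r. (\<forall>i>n. r i = 0) \<and>
      (r 0 - 1 / real k)\<^sup>2 + (\<Sum>i\<in>{1..n}. (r i)\<^sup>2) = (1 / real k)\<^sup>2}"

definition hearring_set :: "nat \<Rightarrow> (nat \<Rightarrow> real) set" where
  "hearring_set n = (\<Union>k\<in>{1..}. hsphere n k)"

definition hearring :: "nat \<Rightarrow> (nat \<Rightarrow> real) topology" where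
  "hearring n = subtopology (Euclidean_space (Suc n)) (hearring_set n)"

text \<open>The weak join \<H>^\<infinity>: a point is either the base point \<theta> = (0, 0) or a pair (n, r)
  with n \<ge> 1 and r a non-zero point of \<H>^n.\<close>
definition theta :: "nat \<times> (nat \<Rightarrow> real)" where
  "theta = (0, (\<lambda>_. 0))"

definition hincl :: "nat \<Rightarrow> (nat \<Rightarrow> real) \<Rightarrow> nat \<times> (nat \<Rightarrow> real)" where
  "hincl n r = (if r = (\<lambda>_. 0) then theta else (n, r))"

definition Hinf_set :: "(nat \<times> (nat \<Rightarrow> real)) set" where
  "Hinf_set = insert theta {(n, r) | n r. 1 \<le> n \<and> r \<in> hearring_set n \<and> r \<noteq> (\<lambda>_. 0)}"

definition Hinf :: "(nat \<times> (nat \<Rightarrow> real)) topology" where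
  "Hinf = topology (\<lambda>U. U \<subseteq> Hinf_set \<and>
      (\<forall>n\<ge>1. openin (hearring n) {r \<in> hearring_set n. hincl n r \<in> U}) \<and>
      (theta \<in> U \<longrightarrow> finite {n. 1 \<le> n \<and> \<not> (hincl n ` hearring_set n \<subseteq> U)}))"

text \<open>Standard identification c_n : I^n \<rightarrow> S^n (unit sphere in \<real>^{n+1}), collapsing \<partial>I^n
  to the point -e_0 and mapping the open cube homeomorphically onto S^n - {-e_0}.\<close>
definition cube_to_sphere :: "nat \<Rightarrow> (nat \<Rightarrow> real) \<Rightarrow> (nat \<Rightarrow> real)" where
  "cube_to_sphere n t =
     (let u = (\<lambda>i. 2 * t i - 1);
          m = Max ((\<lambda>i. \<bar>u i\<bar>) ` {..<n});
          L = sqrt (\<Sum>i<n. (u i)\<^sup>2)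
      in (\<lambda>j. if j = 0 then cos (pi * m)
              else if j \<le> n then (if L = 0 then 0 else sin (pi * m) * u (j - 1) / L)
              else 0))"

text \<open>The similarity S^n_k \<rightarrow> S^n, r \<mapsto> k r - e_0 (sending \<theta> to -e_0).\<close>
definition sphere_normalize :: "nat \<Rightarrow> (nat \<Rightarrow> real) \<Rightarrow> (nat \<Rightarrow> real)" where
  "sphere_normalize k r = (\<lambda>i. real k * r i - (if i = 0 then 1 else 0))"

definition interior_cube :: "nat \<Rightarrow> (nat \<Rightarrow> real) set" where
  "interior_cube n = cube_set n - cube_boundary n"

text \<open>Sphere-wise concatenation: on each S^n_k, (f * g) is the \<pi>_n concatenation of f|S^n_k and g|S^n_k.\<close>
definition Hinf_concat ::
  "(nat \<times> (nat \<Rightarrow> real) \<Rightarrow> 'a) \<Rightarrow> (nat \<times> (nat \<Rightarrow> real) \<Rightarrow> 'a) \<Rightarrow> 'a \<Rightarrow> nat \<times> (nat \<Rightarrow> real) \<Rightarrow> 'a" where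
  "Hinf_concat f g x0 p =
     (if p = theta then x0 else
      (let n = fst p; r = snd p;
           k = (THE k. 1 \<le> k \<and> r \<in> hsphere n k);
           t = (THE t. t \<in> interior_cube n \<and> cube_to_sphere n t = sphere_normalize k r);
           lift = (\<lambda>h s. h (hincl n (\<lambda>i. (cube_to_sphere n s i + (if i = 0 then 1 else 0)) / real k)))
       in cube_concat (lift f) (lift g) t))"

definition Hinf_maps :: "'a topology \<Rightarrow> 'a \<Rightarrow> (nat \<times> (nat \<Rightarrow> real) \<Rightarrow> 'a) set" where
  "Hinf_maps X x0 = {f. continuous_map Hinf X f \<and> f theta = x0}"

definition Hinf_rel :: "'a topology \<Rightarrow> 'a \<Rightarrow> (nat \<times> (nat \<Rightarrow> real) \<Rightarrow> 'a) \<Rightarrow> (nat \<times> (nat \<Rightarrow> real) \<Rightarrow> 'a) \<Rightarrow> bool" where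
  "Hinf_rel X x0 f g = homotopic_with (\<lambda>h. h theta = x0) Hinf X f g"

definition Hinf_group :: "'a topology \<Rightarrow> 'a \<Rightarrow> (nat \<times> (nat \<Rightarrow> real) \<Rightarrow> 'a) set monoid" where
  "Hinf_group X x0 = hclass_group (Hinf_maps X x0) (Hinf_rel X x0) (\<lambda>f g. Hinf_concat f g x0) (\<lambda>_. x0)"

end

theory Submission
  imports Defs
begin

text \<open>The weak join is glued from cells: the sphere with index (n, k) is the quotient of the n-cube by
  its boundary, and a set is open iff its preimage in every cube is open and, if it contains the base
  point, it contains all but finitely many of the spheres. Hence a pointed map is the same as a family
  of maps of cubes such that every neighbourhood of x_0 contains all but finitely many of their images,
  and likewise for homotopies. Let V be a neighbourhood of x_0 that contracts to x_0 in X relative to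
  x_0. All but finitely many spheres are mapped into V, and the one contraction of V contracts all of
  them simultaneously; continuity of this homotopy at the base point follows from the tube lemma. So
  every map is homotopic to one that is constant off finitely many spheres, and the family of the
  homotopy classes on the spheres is a complete invariant with values in the weak product.\<close>

section \<open>Homotopy groups of cubes\<close>

text \<open>Homotopies chosen independently on the single spheres have no common size, so gluing
  infinitely many of them may fail to be continuous at the base point. This obstacle fixes the order
  of the argument: both maps are first replaced by maps that are constant off one common finite set
  of spheres, and cellwise homotopies are used only on the spheres in that set. The contraction of
  V, in contrast, acts on infinitely many spheres at once; since it fixes x_0 at all times and the
  interval is compact, it moves points close to x_0 only through points close to x_0. The
  description of open sets through cubes has to be extracted from the metric definition of H^n: the
  radii 1/k shrink, which bounds the number of exceptional k for each n, and 2 r_0 / |r|^2 recovers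
  k from a nonzero point, which keeps the spheres apart away from the origin. The operation on
  classes is treated sphere by sphere as well: its independence of representatives follows from the
  completeness of the invariant.\<close>

locale hclass_mult =
  fixes M :: "('b \<Rightarrow> 'a) set" and R and opr
  assumes refl: "f \<in> M \<Longrightarrow> R f f"
    and sym: "R f g \<Longrightarrow> R g f"
    and trans: "R f g \<Longrightarrow> R g h \<Longrightarrow> R f h"
    and closed: "f \<in> M \<Longrightarrow> g \<in> M \<Longrightarrow> opr f g \<in> M"
    and cong: "\<lbrakk>f \<in> M; f' \<in> M; g \<in> M; g' \<in> M; R f f'; R g g'\<rbrakk> \<Longrightarrow> R (opr f g) (opr f' g')"
begin

lemma hclass_eq_iff: "f \<in> M \<Longrightarrow> g \<in> M \<Longrightarrow> hclass M R f = hclass M R g \<longleftrightarrow> R f g"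
  unfolding hclass_def using refl sym trans by (smt (verit) Collect_cong mem_Collect_eq)

lemma some_hclass:
  assumes "f \<in> M"
  shows "(SOME g. g \<in> hclass M R f) \<in> M" "R f (SOME g. g \<in> hclass M R f)"
proof -
  have "(SOME g. g \<in> hclass M R f) \<in> hclass M R f"
    by (rule someI[of _ f]) (simp add: hclass_def assms refl)
  then show "(SOME g. g \<in> hclass M R f) \<in> M" "R f (SOME g. g \<in> hclass M R f)"
    by (simp_all add: hclass_def)
qed

lemma carrier_hclass_group: "carrier (hclass_group M R opr e) = hclass M R ` M"
  by (simp add: hclass_group_def)

lemma one_hclass_group: "\<one>\<^bsub>hclass_group M R opr e\<^esub> = hclass M R e"
  by (simp add: hclass_group_def)

text \<open>\<open>hclass_group\<close> multiplies representatives picked by \<open>SOME\<close>;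
  \<open>cong\<close> makes the resulting class independent of the pick.\<close>

lemma mult_hclass_group:
  assumes "f \<in> M" "g \<in> M"
  shows "hclass M R f \<otimes>\<^bsub>hclass_group M R opr e\<^esub> hclass M R g = hclass M R (opr f g)"
proof -
  let ?f = "SOME x. x \<in> hclass M R f" and ?g = "SOME x. x \<in> hclass M R g"
  have "R (opr f g) (opr ?f ?g)"
    by (intro cong some_hclass assms)
  moreover have "opr f g \<in> M" "opr ?f ?g \<in> M"
    by (intro closed some_hclass assms)+
  ultimately have "hclass M R (opr f g) = hclass M R (opr ?f ?g)"
    by (simp add: hclass_eq_iff)
  then show ?thesis by (simp add: hclass_group_def)
qed

lemma group_hclass_group:
  assumes e: "e \<in> M" and unit: "\<And>f. f \<in> M \<Longrightarrow> R (opr e f) f"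
    and assoc: "\<And>f g h. \<lbrakk>f \<in> M; g \<in> M; h \<in> M\<rbrakk> \<Longrightarrow> R (opr (opr f g) h) (opr f (opr g h))"
    and inv: "\<And>f. f \<in> M \<Longrightarrow> \<exists>g\<in>M. R (opr g f) e"
  shows "group (hclass_group M R opr e)"
proof (rule groupI)
  show "\<exists>y\<in>carrier (hclass_group M R opr e). y \<otimes>\<^bsub>hclass_group M R opr e\<^esub> x = \<one>\<^bsub>hclass_group M R opr e\<^esub>"
    if "x \<in> carrier (hclass_group M R opr e)" for x
  proof -
    from that obtain f where f: "f \<in> M" "x = hclass M R f"
      by (auto simp: carrier_hclass_group)
    with inv obtain g where "g \<in> M" "R (opr g f) e" by blast
    with f e show ?thesis
      by (auto simp: carrier_hclass_group one_hclass_group mult_hclass_group hclass_eq_iff closed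
          intro!: bexI[of _ g])
  qed
qed (auto simp: carrier_hclass_group one_hclass_group mult_hclass_group hclass_eq_iff closed
       e unit assoc simp del: One_nat_def del: equalityI)

end

section \<open>The cube as a subspace of the function space\<close>

lemma Euclidean_space_eq: "Euclidean_space n = top_of_set {x. \<forall>i\<ge>n. x i = 0}"
  by (simp add: Euclidean_space_def euclidean_product_topology)

text \<open>The type \<open>nat => real\<close> carries the product topology, so
  \<open>Euclidean_space n\<close> is one of its subspaces, and continuity, compactness and openness
  can be argued with the type-class notions.\<close>

lemma cube_eq: "cube n = top_of_set (cube_set n)"
  unfolding cube_def Euclidean_space_eq subtopology_subtopology
  by (rule arg_cong2[where f=subtopology]) (auto simp: cube_set_def)

lemma topspace_cube [simp]: "topspace (cube n) = cube_set n"
  by (simp add: cube_eq)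

lemma continuous_map_into_cube:
  "continuous_map T (cube n) g \<longleftrightarrow>
     g \<in> topspace T \<rightarrow> cube_set n \<and> (\<forall>i. continuous_map T euclideanreal (\<lambda>x. g x i))"
  unfolding cube_eq euclidean_product_topology[symmetric] continuous_map_in_subtopology
  by (auto simp: continuous_map_componentwise_UNIV)

lemma cube_boundary_subset: "cube_boundary n \<subseteq> cube_set n"
  by (auto simp: cube_boundary_def)

lemma cube_set_update: "t \<in> cube_set n \<Longrightarrow> 1 \<le> n \<Longrightarrow> 0 \<le> x \<Longrightarrow> x \<le> 1 \<Longrightarrow> t(0 := x) \<in> cube_set n"
  by (auto simp: cube_set_def)

text \<open>A boundary point may owe its membership to coordinate 0 or to another one. In the second
  case the update is harmless; the last premise covers the first.\<close>

lemma cube_boundary_update: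
  "t \<in> cube_boundary n \<Longrightarrow> 1 \<le> n \<Longrightarrow> 0 \<le> x \<Longrightarrow> x \<le> 1 \<Longrightarrow>
     (t 0 \<in> {0, 1} \<Longrightarrow> x \<in> {0, 1}) \<Longrightarrow> t(0 := x) \<in> cube_boundary n"
  unfolding cube_boundary_def
  by (smt (verit, best) cube_set_update fun_upd_apply insertE insertI1 insertI2 mem_Collect_eq singletonD)

lemma cube_boundary_update_end:
  "t \<in> cube_set n \<Longrightarrow> 1 \<le> n \<Longrightarrow> x \<in> {0, 1} \<Longrightarrow> t(0 := x) \<in> cube_boundary n"
  by (auto simp: cube_boundary_def cube_set_def)

lemma continuous_map_cube_coord:
  assumes "continuous_map T (cube n) g"
  shows "continuous_map T euclideanreal (\<lambda>x. g x i)"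
  using assms by (simp add: continuous_map_into_cube)

lemma continuous_map_cube_update:
  assumes g: "continuous_map T (cube n) g" and x: "continuous_map T euclideanreal x"
    and n: "1 \<le> n" and rng: "\<And>p. p \<in> topspace T \<Longrightarrow> 0 \<le> x p \<and> x p \<le> 1"
  shows "continuous_map T (cube n) (\<lambda>p. (g p)(0 := x p))"
  unfolding continuous_map_into_cube
proof (intro conjI allI)
  have "g \<in> topspace T \<rightarrow> cube_set n" 
    using g by (simp add: continuous_map_into_cube)
  then show "(\<lambda>p. (g p)(0 := x p)) \<in> topspace T \<rightarrow> cube_set n"
    using rng n by (auto intro!: cube_set_update)
  show "continuous_map T euclideanreal (\<lambda>p. ((g p)(0 := x p)) i)" for i
    using x continuous_map_cube_coord[OF g] by (cases "i = 0") auto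
qed

lemma cube_coord0: "t \<in> cube_set n \<Longrightarrow> 1 \<le> n \<Longrightarrow> 0 \<le> t 0 \<and> t 0 \<le> 1"
  by (auto simp: cube_set_def)

text \<open>\<open>Z\<close> is a parameter space, so the same pasting serves for homotopies. At t_0
  = 1/2 the rescaled points have coordinate 0 equal to 1 and 0, so both lie on a face, where
  \<open>F\<close> and \<open>G\<close> are x_0.\<close>

lemma continuous_map_cube_concat:
  assumes F: "continuous_map (prod_topology Z (cube n)) X F"
    and G: "continuous_map (prod_topology Z (cube n)) X G"
    and bF: "\<And>z t. z \<in> topspace Z \<Longrightarrow> t \<in> cube_boundary n \<Longrightarrow> F (z, t) = x0"
    and bG: "\<And>z t. z \<in> topspace Z \<Longrightarrow> t \<in> cube_boundary n \<Longrightarrow> G (z, t) = x0"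
    and n: "1 \<le> n"
  shows "continuous_map (prod_topology Z (cube n)) X
           (\<lambda>p. cube_concat (\<lambda>t. F (fst p, t)) (\<lambda>t. G (fst p, t)) (snd p))"
proof -
  let ?P = "prod_topology Z (cube n)"
  have coord: "continuous_map ?P euclideanreal (\<lambda>p. snd p 0)"
    by (rule continuous_map_cube_coord) (rule continuous_map_snd)
  have "continuous_map ?P X (\<lambda>p. if snd p 0 \<le> 1/2 then F (fst p, (snd p)(0 := 2 * snd p 0))
      else G (fst p, (snd p)(0 := 2 * snd p 0 - 1)))"
  proof (rule continuous_map_cases_le[OF coord])
    let ?A = "subtopology ?P {x \<in> topspace ?P. snd x 0 \<le> 1 / 2}"
    let ?B = "subtopology ?P {x \<in> topspace ?P. 1 / 2 \<le> snd x 0}"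
    have A: "continuous_map ?A ?P (\<lambda>p. (fst p, (snd p)(0 := 2 * snd p 0)))"
      by (intro continuous_map_pairedI continuous_map_cube_update continuous_map_from_subtopology
           continuous_map_fst continuous_map_snd continuous_map_real_mult coord n)
         (use n in \<open>auto dest: cube_coord0\<close>)
    have B: "continuous_map ?B ?P (\<lambda>p. (fst p, (snd p)(0 := 2 * snd p 0 - 1)))"
      by (intro continuous_map_pairedI continuous_map_cube_update continuous_map_from_subtopology
           continuous_map_fst continuous_map_snd continuous_map_real_mult continuous_map_diff coord n)
         (use n in \<open>auto dest: cube_coord0\<close>)
    show "continuous_map ?A X (\<lambda>p. F (fst p, (snd p)(0 := 2 * snd p 0)))"
      using continuous_map_compose[OF A F] by (simp add: o_def)
    show "continuous_map ?B X (\<lambda>p. G (fst p, (snd p)(0 := 2 * snd p 0 - 1)))"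
      using continuous_map_compose[OF B G] by (simp add: o_def)
    show "F (fst x, (snd x)(0 := 2 * snd x 0)) = G (fst x, (snd x)(0 := 2 * snd x 0 - 1))"
      if "x \<in> topspace ?P" "snd x 0 = 1/2" for x
      using that bF bG n by (auto simp: cube_boundary_update_end)
  qed auto
  then show ?thesis
    by (simp add: cube_concat_def)
qed

text \<open>\<open>homotopic_with\<close> prescribes the two ends on the whole type. The boundary
  condition depends only on values in the cube, so prescribing the ends there is equally
  good.\<close>

lemma pi_rel_iff:
  "pi_rel n X x0 f g \<longleftrightarrow>
     (\<exists>h. continuous_map (prod_topology (top_of_set {0..1::real}) (cube n)) X h \<and>
        (\<forall>t\<in>cube_set n. h (0, t) = f t) \<and> (\<forall>t\<in>cube_set n. h (1, t) = g t) \<and>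
        (\<forall>s\<in>{0..1}. \<forall>t\<in>cube_boundary n. h (s, t) = x0))"
  unfolding pi_rel_def
proof (subst homotopic_with)
  show "(\<forall>t\<in>cube_boundary n. h t = x0) \<longleftrightarrow> (\<forall>t\<in>cube_boundary n. k t = x0)"
    if "\<And>t. t \<in> topspace (cube n) \<Longrightarrow> h t = k t" for h k
    using that cube_boundary_subset[of n] by (metis subsetD topspace_cube)
qed auto

lemma pi_relE:
  assumes "pi_rel n X x0 f g"
  obtains h where "continuous_map (prod_topology (top_of_set {0..1::real}) (cube n)) X h"
    "\<And>t. t \<in> cube_set n \<Longrightarrow> h (0, t) = f t" "\<And>t. t \<in> cube_set n \<Longrightarrow> h (1, t) = g t"
    "\<And>s t. s \<in> {0..1} \<Longrightarrow> t \<in> cube_boundary n \<Longrightarrow> h (s, t) = x0"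
  using assms unfolding pi_rel_iff by blast

lemma pi_rel_refl: "f \<in> pi_maps n X x0 \<Longrightarrow> pi_rel n X x0 f f"
  by (auto simp: pi_rel_def pi_maps_def)

lemma pi_rel_sym: "pi_rel n X x0 f g \<Longrightarrow> pi_rel n X x0 g f"
  by (auto simp: pi_rel_def intro: homotopic_with_symD)

lemma pi_rel_trans: "pi_rel n X x0 f g \<Longrightarrow> pi_rel n X x0 g h \<Longrightarrow> pi_rel n X x0 f h"
  by (auto simp: pi_rel_def intro: homotopic_with_trans)

lemma pi_rel_imp_maps:
  assumes "pi_rel n X x0 f g"
  shows "f \<in> pi_maps n X x0" "g \<in> pi_maps n X x0"
  using assms unfolding pi_rel_def pi_maps_def
  by (auto dest: homotopic_with_imp_continuous_maps homotopic_with_imp_property)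

text \<open>Elements of \<open>pi_maps\<close> are total functions with arbitrary values off the
  cube, so equality on the cube has to be turned into a homotopy.\<close>

lemma pi_rel_equal:
  assumes "f \<in> pi_maps n X x0" "\<And>t. t \<in> cube_set n \<Longrightarrow> f t = g t"
  shows "pi_rel n X x0 f g"
  unfolding pi_rel_def using assms cube_boundary_subset
  by (intro homotopic_with_equal) (auto simp: pi_maps_def subset_iff)

lemma const_in_pi_maps: "x0 \<in> topspace X \<Longrightarrow> (\<lambda>_. x0) \<in> pi_maps n X x0"
  by (simp add: pi_maps_def)

lemma pi_rel_cube_concat:
  assumes "pi_rel n X x0 f f'" "pi_rel n X x0 g g'" and n: "1 \<le> n"
  shows "pi_rel n X x0 (cube_concat f g) (cube_concat f' g')"
proof -
  let ?P = "prod_topology (top_of_set {0..1::real}) (cube n)"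
  obtain h where h: "continuous_map ?P X h" "\<And>t. t \<in> cube_set n \<Longrightarrow> h (0, t) = f t"
    "\<And>t. t \<in> cube_set n \<Longrightarrow> h (1, t) = f' t"
    "\<And>s t. s \<in> {0..1} \<Longrightarrow> t \<in> cube_boundary n \<Longrightarrow> h (s, t) = x0"
    using pi_relE[OF assms(1)] by blast
  obtain k where k: "continuous_map ?P X k" "\<And>t. t \<in> cube_set n \<Longrightarrow> k (0, t) = g t"
    "\<And>t. t \<in> cube_set n \<Longrightarrow> k (1, t) = g' t"
    "\<And>s t. s \<in> {0..1} \<Longrightarrow> t \<in> cube_boundary n \<Longrightarrow> k (s, t) = x0"
    using pi_relE[OF assms(2)] by blast
  have half: "cube_concat u v t = cube_concat u' v' t"
    if "t \<in> cube_set n" "\<And>t. t \<in> cube_set n \<Longrightarrow> u t = u' t" "\<And>t. t \<in> cube_set n \<Longrightarrow> v t = v' t"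
    for t and u v u' v' :: "(nat \<Rightarrow> real) \<Rightarrow> 'a"
    unfolding cube_concat_def using that n cube_coord0[OF that(1) n] by (auto simp: cube_set_update)
  have "continuous_map ?P X (\<lambda>p. cube_concat (\<lambda>t. h (fst p, t)) (\<lambda>t. k (fst p, t)) (snd p))"
    by (rule continuous_map_cube_concat) (use h k n in auto)
  moreover have "cube_concat (\<lambda>t. h (s, t)) (\<lambda>t. k (s, t)) t = x0"
    if "s \<in> {0..1}" "t \<in> cube_boundary n" for s t
  proof -
    have "t \<in> cube_set n" using that cube_boundary_subset by auto
    then show ?thesis
      using that n h(4) k(4) cube_coord0[of t n]
      by (auto simp: cube_concat_def intro!: h(4) k(4) cube_boundary_update)
  qed
  moreover have "cube_concat (\<lambda>t. h (0, t)) (\<lambda>t. k (0, t)) t = cube_concat f g t"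
    "cube_concat (\<lambda>t. h (1, t)) (\<lambda>t. k (1, t)) t = cube_concat f' g' t" if "t \<in> cube_set n" for t
    by (rule half[OF that]; simp add: h k)+
  ultimately show ?thesis
    unfolding pi_rel_iff
    by (intro exI[of _ "\<lambda>p. cube_concat (\<lambda>t. h (fst p, t)) (\<lambda>t. k (fst p, t)) (snd p)"]) simp
qed

lemma cube_concat_in_pi_maps:
  assumes "f \<in> pi_maps n X x0" "g \<in> pi_maps n X x0" "1 \<le> n"
  shows "cube_concat f g \<in> pi_maps n X x0"
  by (rule pi_rel_imp_maps(1)[OF pi_rel_cube_concat[OF pi_rel_refl pi_rel_refl]]) fact+

text \<open>The homotopy interpolates linearly between \<phi> and \<psi>; convexity keeps it in
  [0, 1]. On the faces t_0 = 0 and t_0 = 1 both agree and take an end value, so the interpolation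
  stays on the boundary. The unit, associativity and inverse laws are all instances; \<phi> may send
  both ends to the same face.\<close>

lemma pi_rel_reparam:
  assumes f: "f \<in> pi_maps n X x0" and n: "1 \<le> n"
    and cont: "continuous_on {0..1} \<phi>" "continuous_on {0..1} \<psi>"
    and rng: "\<phi> ` {0..1} \<subseteq> {0..1}" "\<psi> ` {0..1} \<subseteq> {0..1}"
    and ends: "\<phi> 0 = \<psi> 0" "\<phi> 1 = \<psi> 1" "\<phi> 0 \<in> {0, 1}" "\<phi> 1 \<in> {0, 1 :: real}"
  shows "pi_rel n X x0 (\<lambda>t. f (t(0 := \<phi> (t 0)))) (\<lambda>t. f (t(0 := \<psi> (t 0))))"
proof -
  let ?P = "prod_topology (top_of_set {0..1::real}) (cube n)"
  let ?m = "\<lambda>p. (1 - fst p) * \<phi> (snd p 0) + fst p * \<psi> (snd p 0)"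
  have rng01: "0 \<le> ?m (s, t) \<and> ?m (s, t) \<le> 1" if "s \<in> {0..1}" "t \<in> cube_set n" for s t
  proof -
    have "t 0 \<in> {0..1}" using that cube_coord0[of t n] n by auto
    with rng have "\<phi> (t 0) \<in> {0..1}" "\<psi> (t 0) \<in> {0..1}" by blast+
    with that show ?thesis
      using convex_bound_le[of "\<phi> (t 0)" 1 "\<psi> (t 0)" "1 - s" s] by auto
  qed
  have coord: "continuous_map ?P (top_of_set {0..1}) (\<lambda>p. snd p 0)"
    using n by (auto simp: continuous_map_in_subtopology dest: cube_coord0
        intro!: continuous_map_cube_coord continuous_map_snd)
  have "continuous_map ?P euclideanreal (\<lambda>p. \<phi> (snd p 0))"
    using continuous_map_compose[OF coord, of euclideanreal \<phi>] cont by (simp add: o_def)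
  moreover have "continuous_map ?P euclideanreal (\<lambda>p. \<psi> (snd p 0))"
    using continuous_map_compose[OF coord, of euclideanreal \<psi>] cont by (simp add: o_def)
  moreover have "continuous_map ?P euclideanreal fst"
    using continuous_map_fst continuous_map_into_fulltopology by blast
  ultimately have "continuous_map ?P euclideanreal ?m"
    by (intro continuous_map_add continuous_map_real_mult continuous_map_diff) auto
  then have "continuous_map ?P (cube n) (\<lambda>p. (snd p)(0 := ?m p))"
    using n rng01 by (intro continuous_map_cube_update continuous_map_snd) auto
  then have "continuous_map ?P X (f \<circ> (\<lambda>p. (snd p)(0 := ?m p)))"
    using f by (intro continuous_map_compose) (auto simp: pi_maps_def)
  moreover have "f (t(0 := ?m (s, t))) = x0" if "s \<in> {0..1}" "t \<in> cube_boundary n" for s t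
  proof -
    have "t(0 := ?m (s, t)) \<in> cube_boundary n"
    proof (rule cube_boundary_update)
      show "0 \<le> ?m (s, t)" "?m (s, t) \<le> 1"
        using rng01 that cube_boundary_subset by blast+
      show "?m (s, t) \<in> {0, 1}" if "t 0 \<in> {0, 1}"
        using that ends by (auto simp: algebra_simps)
    qed (use that n in auto)
    then show ?thesis using f by (simp add: pi_maps_def)
  qed
  ultimately show ?thesis
    unfolding pi_rel_iff by (intro exI[of _ "f \<circ> (\<lambda>p. (snd p)(0 := ?m p))"]) auto
qed

lemma hclass_mult_pi:
  assumes "1 \<le> n"
  shows "hclass_mult (pi_maps n X x0) (pi_rel n X x0) cube_concat"
proof
  show "pi_rel n X x0 f h" if "pi_rel n X x0 f g" "pi_rel n X x0 g h" for f g h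
    using that by (rule pi_rel_trans)
  show "cube_concat f g \<in> pi_maps n X x0" if "f \<in> pi_maps n X x0" "g \<in> pi_maps n X x0" for f g
    using that assms by (rule cube_concat_in_pi_maps)
  show "pi_rel n X x0 (cube_concat f g) (cube_concat f' g')"
    if "pi_rel n X x0 f f'" "pi_rel n X x0 g g'" for f f' g g'
    using that assms by (rule pi_rel_cube_concat)
qed (fact pi_rel_refl pi_rel_sym)+

lemma cube_concat_const_left:
  assumes f: "f \<in> pi_maps n X x0" and n: "1 \<le> n"
  shows "pi_rel n X x0 (cube_concat (\<lambda>_. x0) f) f"
proof -
  \<comment> \<open>\<open>max 0 (2 x - 1)\<close> waits at 0 during the first half, where
    \<open>f\<close> sits on a face and equals x_0, and then runs through \<open>f\<close> at double
    speed.\<close>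
  have 1: "pi_rel n X x0 (\<lambda>t. f (t(0 := max 0 (2 * t 0 - 1)))) (\<lambda>t. f (t(0 := id (t 0))))"
    by (rule pi_rel_reparam[OF f n]) (auto intro!: continuous_intros)
  have "pi_rel n X x0 (\<lambda>t. f (t(0 := max 0 (2 * t 0 - 1)))) (cube_concat (\<lambda>_. x0) f)"
  proof (rule pi_rel_equal[OF pi_rel_imp_maps(1)[OF 1]])
    fix t assume "t \<in> cube_set n"
    then show "f (t(0 := max 0 (2 * t 0 - 1))) = cube_concat (\<lambda>_. x0) f t"
      using f n cube_boundary_update_end[of t n 0]
      by (cases "t 0 \<le> 1/2") (simp_all add: cube_concat_def pi_maps_def max_absorb1 max_absorb2)
  qed
  from pi_rel_trans[OF pi_rel_sym[OF this] 1] show ?thesis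
    unfolding id_apply fun_upd_triv .
qed

text \<open>The break points 1/4, 1/2 of the left bracketing are carried to 1/2, 3/4, those of the
  right one. After this substitution the two sides are equal as functions on the whole type, and
  \<open>pi_rel_reparam\<close> against the identity finishes the proof.\<close>

lemma cube_concat_assoc:
  assumes "f \<in> pi_maps n X x0" "g \<in> pi_maps n X x0" "h \<in> pi_maps n X x0" and n: "1 \<le> n"
  shows "pi_rel n X x0 (cube_concat (cube_concat f g) h) (cube_concat f (cube_concat g h))"
proof -
  let ?k = "cube_concat f (cube_concat g h)"
  \<comment> \<open>piecewise linear with slopes 2, 1, 1/2, hence concave and a minimum of three affine maps\<close>
  define \<phi> :: "real \<Rightarrow> real" where "\<phi> x = min (2 * x) (min (x + 1/4) ((x + 1) / 2))" for x
  have k: "?k \<in> pi_maps n X x0" using assms by (intro cube_concat_in_pi_maps)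
  have 1: "pi_rel n X x0 (\<lambda>t. ?k (t(0 := \<phi> (t 0)))) (\<lambda>t. ?k (t(0 := id (t 0))))"
  proof (rule pi_rel_reparam[OF k n])
    show "continuous_on {0..1} \<phi>"
      unfolding \<phi>_def by (intro continuous_intros) auto
  qed (auto simp: \<phi>_def min_def)
  have 2: "(\<lambda>t. ?k (t(0 := \<phi> (t 0)))) = cube_concat (cube_concat f g) h"
  proof
    fix t :: "nat \<Rightarrow> real"
    consider "t 0 \<le> 1/4" | "1/4 < t 0" "t 0 \<le> 1/2" | "1/2 < t 0" by linarith
    then show "?k (t(0 := \<phi> (t 0))) = cube_concat (cube_concat f g) h t"
    proof cases
      case 1
      then have \<phi>: "\<phi> (t 0) = 2 * t 0" by (auto simp: \<phi>_def)
      show ?thesis using 1 unfolding \<phi> cube_concat_def by simp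
    next
      case 2
      define y where "y = t 0 + 1/4"
      have \<phi>: "\<phi> (t 0) = y" using 2 unfolding \<phi>_def y_def by (simp add: min_def)
      have y: "\<not> y \<le> 1/2" "2 * y - 1 \<le> 1/2" "2 * (2 * y - 1) = 2 * (2 * t 0) - 1"
        using 2 unfolding y_def by auto
      have "?k (t(0 := y)) = g (t(0 := 2 * (2 * y - 1)))"
        using y(1,2) unfolding cube_concat_def by simp
      also have "\<dots> = cube_concat (cube_concat f g) h t"
        using 2 unfolding y(3) cube_concat_def by simp
      finally show ?thesis unfolding \<phi> .
    next
      case 3
      define y where "y = (t 0 + 1) / 2"
      have \<phi>: "\<phi> (t 0) = y" using 3 unfolding \<phi>_def y_def by (simp add: min_def)
      have y: "\<not> y \<le> 1/2" "2 * y - 1 = t 0" using 3 unfolding y_def by (auto simp: field_simps)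
      have "?k (t(0 := y)) = cube_concat g h (t(0 := 2 * y - 1))"
        using y(1) unfolding cube_concat_def by simp
      also have "\<dots> = h (t(0 := 2 * t 0 - 1))"
        using 3 unfolding y(2) fun_upd_triv cube_concat_def by simp
      also have "\<dots> = cube_concat (cube_concat f g) h t"
        using 3 unfolding cube_concat_def by simp
      finally show ?thesis unfolding \<phi> .
    qed
  qed
  have 3: "(\<lambda>t. ?k (t(0 := id (t 0)))) = ?k" by simp
  show ?thesis by (rule subst[where P="\<lambda>u. pi_rel n X x0 u ?k", OF 2])
     (rule subst[where P="pi_rel n X x0 _", OF 3], rule 1)
qed

text \<open>The inverse runs through coordinate 0 backwards. Its concatenation with \<open>f\<close>
  is \<open>f\<close> along |2 x - 1|, a path from 1 to 0 and back, which deforms with fixed ends to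
  the constant path at 1, that is, onto a face.\<close>

lemma cube_concat_inverse:
  assumes f: "f \<in> pi_maps n X x0" and n: "1 \<le> n"
  shows "\<exists>g\<in>pi_maps n X x0. pi_rel n X x0 (cube_concat g f) (\<lambda>_. x0)"
proof
  let ?g = "\<lambda>t. f (t(0 := 1 - t 0))"
  \<comment> \<open>Comparing the reparametrization with itself yields continuity and the boundary
    condition of \<open>?g\<close> at once.\<close>
  have "pi_rel n X x0 ?g ?g"
    by (rule pi_rel_reparam[OF f n]) (auto intro!: continuous_intros)
  then show "?g \<in> pi_maps n X x0" by (rule pi_rel_imp_maps)
  have "(\<lambda>t. f (t(0 := \<bar>2 * t 0 - 1\<bar>))) = cube_concat ?g f"
    by (auto simp: fun_eq_iff cube_concat_def)
  moreover have "pi_rel n X x0 (\<lambda>t. f (t(0 := \<bar>2 * t 0 - 1\<bar>))) (\<lambda>t. f (t(0 := 1)))"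
    by (rule pi_rel_reparam[OF f n]) (auto intro!: continuous_intros)
  ultimately have 1: "pi_rel n X x0 (cube_concat ?g f) (\<lambda>t. f (t(0 := 1)))" by simp
  have "pi_rel n X x0 (\<lambda>t. f (t(0 := 1))) (\<lambda>_. x0)"
  proof (rule pi_rel_equal)
    show "f (t(0 := 1)) = x0" if "t \<in> cube_set n" for t
      using f n cube_boundary_update_end[OF that, of 1] by (simp add: pi_maps_def)
  qed (rule pi_rel_imp_maps(2)[OF 1])
  with 1 show "pi_rel n X x0 (cube_concat ?g f) (\<lambda>_. x0)"
    by (rule pi_rel_trans)
qed

lemma group_pi_group:
  assumes "1 \<le> n" "x0 \<in> topspace X"
  shows "group (pi_group n X x0)"
  unfolding pi_group_def
proof (rule hclass_mult.group_hclass_group[OF hclass_mult_pi[OF assms(1)]])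
  show "(\<lambda>_. x0) \<in> pi_maps n X x0"
    using assms(2) by (rule const_in_pi_maps)
qed (fact cube_concat_const_left[OF _ assms(1)] cube_concat_assoc[OF _ _ _ assms(1)]
       cube_concat_inverse[OF _ assms(1)])+

section \<open>The collapse of the cube onto the sphere\<close>

text \<open>With u = 2 t - 1 this is the sup norm and \<open>cube_len\<close> the Euclidean norm of
  u. The collapse sends the cubical shell of sup norm m to the parallel at angle pi m from e_0, and
  u / |u| gives the direction on it.\<close>

definition cube_max :: "nat \<Rightarrow> (nat \<Rightarrow> real) \<Rightarrow> real" where
  "cube_max n t = Max ((\<lambda>i. \<bar>2 * t i - 1\<bar>) ` {..<n})"

definition cube_len :: "nat \<Rightarrow> (nat \<Rightarrow> real) \<Rightarrow> real" where
  "cube_len n t = sqrt (\<Sum>i<n. (2 * t i - 1)\<^sup>2)"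

lemma cube_to_sphere_eq:
  "cube_to_sphere n t j =
     (if j = 0 then cos (pi * cube_max n t)
      else if j \<le> n then
        (if cube_len n t = 0 then 0 else sin (pi * cube_max n t) * (2 * t (j - 1) - 1) / cube_len n t)
      else 0)"
  by (simp add: cube_to_sphere_def cube_max_def cube_len_def Let_def)

lemma cube_max_ge: "i < n \<Longrightarrow> \<bar>2 * t i - 1\<bar> \<le> cube_max n t"
  unfolding cube_max_def by (rule Max_ge) auto

lemma cube_max_attained:
  assumes "1 \<le> n"
  obtains i where "i < n" "\<bar>2 * t i - 1\<bar> = cube_max n t"
proof -
  have "cube_max n t \<in> (\<lambda>i. \<bar>2 * t i - 1\<bar>) ` {..<n}"
    unfolding cube_max_def using assms by (intro Max_in) (auto simp: lessThan_empty_iff)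
  then show ?thesis using that by auto
qed

lemma cube_max_eqI:
  assumes "\<And>i. i < n \<Longrightarrow> \<bar>2 * t i - 1\<bar> \<le> a" "i < n" "\<bar>2 * t i - 1\<bar> = a"
  shows "cube_max n t = a"
  unfolding cube_max_def using assms by (intro Max_eqI) auto

lemma cube_max_nonneg: "1 \<le> n \<Longrightarrow> 0 \<le> cube_max n t"
  using cube_max_attained[of n t] by (metis abs_ge_zero)

lemma cube_len_ge: "i < n \<Longrightarrow> \<bar>2 * t i - 1\<bar> \<le> cube_len n t"
  unfolding cube_len_def
  by (rule real_le_rsqrt) (auto intro!: member_le_sum[of i "{..<n}" "\<lambda>i. (2 * t i - 1)\<^sup>2", simplified])

lemma cube_len_nonneg: "0 \<le> cube_len n t"
  by (simp add: cube_len_def sum_nonneg)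

lemma cube_max_le_len: "1 \<le> n \<Longrightarrow> cube_max n t \<le> cube_len n t"
  using cube_max_attained[of n t] cube_len_ge by metis

lemma cube_len_eq_0_iff:
  assumes "1 \<le> n"
  shows "cube_len n t = 0 \<longleftrightarrow> cube_max n t = 0"
proof
  show "cube_max n t = 0" if "cube_len n t = 0"
    using that cube_max_le_len[OF assms, of t] cube_max_nonneg[OF assms, of t] by simp
  show "cube_len n t = 0" if "cube_max n t = 0"
    using cube_max_ge[of _ n t] that by (simp add: cube_len_def)
qed

lemma cube_max_le_1: "1 \<le> n \<Longrightarrow> t \<in> cube_set n \<Longrightarrow> cube_max n t \<le> 1"
  by (rule cube_max_attained[of n t]) (auto simp: cube_set_def)

lemma cube_boundary_iff:
  assumes "1 \<le> n" "t \<in> cube_set n"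
  shows "t \<in> cube_boundary n \<longleftrightarrow> cube_max n t = 1"
proof
  assume "t \<in> cube_boundary n"
  then obtain i where i: "i < n" "\<bar>2 * t i - 1\<bar> = 1" by (auto simp: cube_boundary_def)
  from cube_max_ge[OF i(1), of t] i(2) cube_max_le_1[OF assms] show "cube_max n t = 1" by simp
next
  assume 1: "cube_max n t = 1"
  obtain i where "i < n" "\<bar>2 * t i - 1\<bar> = cube_max n t"
    using cube_max_attained assms(1) by blast
  with 1 assms(2) show "t \<in> cube_boundary n" by (auto simp: cube_boundary_def abs_if split: if_splits)
qed

lemma interior_cube_iff:
  assumes "1 \<le> n"
  shows "t \<in> interior_cube n \<longleftrightarrow> t \<in> cube_set n \<and> cube_max n t < 1"
  using cube_boundary_iff[OF assms, of t] cube_max_le_1[OF assms, of t]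
  by (auto simp: interior_cube_def)

lemma continuous_on_Max:
  fixes f :: "'i \<Rightarrow> 'b::topological_space \<Rightarrow> real"
  assumes "finite A" "A \<noteq> {}" "\<And>i. i \<in> A \<Longrightarrow> continuous_on S (f i)"
  shows "continuous_on S (\<lambda>x. Max ((\<lambda>i. f i x) ` A))"
  using assms
proof (induction A rule: finite_ne_induct)
  case (insert a A)
  then have "continuous_on S (\<lambda>x. max (f a x) (Max ((\<lambda>i. f i x) ` A)))"
    by (intro continuous_on_max) auto
  with insert show ?case by simp
qed simp

lemma continuous_on_coord: "continuous_on S (\<lambda>t::nat \<Rightarrow> real. t i)"
  by (rule continuous_on_product_then_coordinatewise[OF continuous_on_id])

lemma continuous_on_cube_max: "1 \<le> n \<Longrightarrow> continuous_on S (cube_max n)"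
  unfolding cube_max_def[abs_def]
  by (intro continuous_on_Max continuous_intros continuous_on_coord) (auto simp: lessThan_empty_iff)

lemma continuous_on_cube_len: "continuous_on S (cube_len n)"
  unfolding cube_len_def[abs_def]
  by (intro continuous_intros continuous_on_coord)

text \<open>Only the centre of the cube, where the direction u / |u| is undefined, needs care: each
  component of the direction is at most 1 in absolute value and is multiplied by sin (pi m), which
  tends to 0 there.\<close>

lemma continuous_on_cube_to_sphere:
  assumes n: "1 \<le> n"
  shows "continuous_on S (cube_to_sphere n)"
proof (rule continuous_on_coordinatewise_then_product)
  fix j
  let ?m = "cube_max n" and ?L = "cube_len n"
  let ?q = "\<lambda>t. sin (pi * ?m t) * (2 * t (j - 1) - 1) / ?L t"
  let ?g = "\<lambda>t. if ?L t = 0 then 0 else ?q t"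
  have m: "continuous (at x within S) ?m" and L: "continuous (at x within S) ?L"
    and c: "continuous (at x within S) (\<lambda>t. t (j - 1))" if "x \<in> S" for x
    using continuous_on_cube_max[OF n, of S] continuous_on_cube_len[of S n] continuous_on_coord[of S "j - 1"]
      that by (auto simp: continuous_on_eq_continuous_within)
  have "continuous_on S ?g" if j: "j \<noteq> 0" "j \<le> n"
    unfolding continuous_on_eq_continuous_within
  proof
    fix x assume x: "x \<in> S"
    show "continuous (at x within S) ?g"
    proof (cases "?L x = 0")
      case False
      then have "continuous (at x within S) ?q"
        by (intro continuous_intros m L c x)
      then have "(?q \<longlongrightarrow> ?g x) (at x within S)"
        using False by (simp add: continuous_within)
      moreover have "\<forall>\<^sub>F t in at x within S. ?q t = ?g t"
        using tendsto_imp_eventually_ne[OF L[OF x, unfolded continuous_within] False]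
        by eventually_elim simp
      ultimately show ?thesis
        unfolding continuous_within by (rule Lim_transform_eventually)
    next
      case True
      then have m0: "?m x = 0" using cube_len_eq_0_iff[OF n] by blast
      have "continuous (at x within S) (\<lambda>t. \<bar>sin (pi * ?m t)\<bar>)"
        by (intro continuous_intros m x)
      then have lim: "((\<lambda>t. \<bar>sin (pi * ?m t)\<bar>) \<longlongrightarrow> 0) (at x within S)"
        by (simp add: continuous_within m0)
      have "norm (?g t) \<le> \<bar>sin (pi * ?m t)\<bar>" for t
      proof (cases "?L t = 0")
        case False
        with cube_len_nonneg[of n t] have pos: "0 < ?L t" by linarith
        have "\<bar>2 * t (j - 1) - 1\<bar> \<le> ?L t" using j n by (intro cube_len_ge) auto
        then have "\<bar>sin (pi * ?m t)\<bar> * \<bar>2 * t (j - 1) - 1\<bar> \<le> \<bar>sin (pi * ?m t)\<bar> * ?L t"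
          by (rule mult_left_mono) simp
        with pos show ?thesis by (simp add: abs_mult divide_simps)
      qed simp
      then have "(?g \<longlongrightarrow> 0) (at x within S)"
        by (intro Lim_null_comparison[OF _ lim]) (auto intro: always_eventually)
      with True show ?thesis by (simp add: continuous_within)
    qed
  qed
  moreover have "continuous_on S (\<lambda>t. cos (pi * ?m t))"
    by (intro continuous_intros continuous_on_cube_max n)
  ultimately show "continuous_on S (\<lambda>t. cube_to_sphere n t j)"
    unfolding cube_to_sphere_eq by (cases "j = 0"; cases "j \<le> n") simp_all
qed

section \<open>The open cube as the punctured sphere\<close>

definition unit_sphere :: "nat \<Rightarrow> (nat \<Rightarrow> real) set" where
  "unit_sphere n = {y. (\<forall>i>n. y i = 0) \<and> (y 0)\<^sup>2 + (\<Sum>i<n. (y (Suc i))\<^sup>2) = 1}"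

lemma cube_len_sq: "(\<Sum>i<n. (2 * t i - 1)\<^sup>2) = (cube_len n t)\<^sup>2"
  by (simp add: cube_len_def sum_nonneg)

lemma cube_to_sphere_unit:
  assumes n: "1 \<le> n"
  shows "cube_to_sphere n t \<in> unit_sphere n"
proof (cases "cube_len n t = 0")
  case True
  then have "cube_max n t = 0" using cube_len_eq_0_iff[OF n] by blast
  with True show ?thesis by (simp add: unit_sphere_def cube_to_sphere_eq)
next
  case False
  have "(\<Sum>i<n. (cube_to_sphere n t (Suc i))\<^sup>2)
      = (\<Sum>i<n. (sin (pi * cube_max n t) / cube_len n t)\<^sup>2 * (2 * t i - 1)\<^sup>2)"
    using False by (intro sum.cong) (auto simp: cube_to_sphere_eq power_mult_distrib power_divide)
  also have "\<dots> = (sin (pi * cube_max n t))\<^sup>2"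
    using False by (simp add: sum_distrib_left[symmetric] sum_divide_distrib[symmetric] cube_len_sq power_divide)
  finally show ?thesis by (simp add: unit_sphere_def cube_to_sphere_eq)
qed

lemma cube_to_sphere_boundary:
  assumes "1 \<le> n" "t \<in> cube_boundary n"
  shows "cube_to_sphere n t = (\<lambda>i. if i = 0 then -1 else 0)"
proof -
  have "cube_max n t = 1"
    using assms cube_boundary_iff cube_boundary_subset by blast
  then show ?thesis by (auto simp: fun_eq_iff cube_to_sphere_eq)
qed

lemma cube_to_sphere_interior:
  assumes "1 \<le> n" "t \<in> interior_cube n"
  shows "cube_to_sphere n t 0 \<noteq> -1"
proof
  assume "cube_to_sphere n t 0 = -1"
  then have "cos (pi * cube_max n t) = cos pi" by (simp add: cube_to_sphere_eq)
  moreover have "cube_max n t < 1" "0 \<le> cube_max n t"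
    using assms interior_cube_iff cube_max_nonneg by auto
  ultimately have "pi * cube_max n t = pi"
    by (rule_tac cos_inj_pi) (simp_all add: mult_le_cancel_left1)
  with \<open>cube_max n t < 1\<close> show False by simp
qed

lemma cube_eqI:
  assumes "s \<in> cube_set n" "t \<in> cube_set n" "\<And>i. i < n \<Longrightarrow> s i = t i"
  shows "s = t"
proof
  show "s i = t i" for i using assms by (cases "i < n") (auto simp: cube_set_def)
qed

text \<open>Equal latitudes give equal sup norms, since cos is injective on [0, pi]. The remaining
  coordinates then show that the centred points are positive multiples of each other, and equal
  nonzero sup norms make the factor 1.\<close>

lemma cube_to_sphere_inj:
  assumes n: "1 \<le> n" and s: "s \<in> interior_cube n" and t: "t \<in> interior_cube n"
    and eq: "cube_to_sphere n s = cube_to_sphere n t"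
  shows "s = t"
proof (rule cube_eqI)
  show sc: "s \<in> cube_set n" and tc: "t \<in> cube_set n"
    using s t by (auto simp: interior_cube_def)
  have lt: "cube_max n s < 1" "cube_max n t < 1" and ge: "0 \<le> cube_max n s" "0 \<le> cube_max n t"
    using s t interior_cube_iff[OF n] cube_max_nonneg[OF n] by auto
  have "pi * cube_max n s = pi * cube_max n t"
    using fun_cong[OF eq, of 0] lt ge
    by (rule_tac cos_inj_pi) (simp_all add: cube_to_sphere_eq mult_le_cancel_left1)
  then have m: "cube_max n s = cube_max n t" by simp
  show "s i = t i" if i: "i < n" for i
  proof (cases "cube_max n t = 0")
    case True
    with m cube_max_ge[OF i, of s] cube_max_ge[OF i, of t] show ?thesis by simp
  next
    case False
    let ?a = "cube_len n s" and ?b = "cube_len n t"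
    have "?a \<noteq> 0" "?b \<noteq> 0" using False m cube_len_eq_0_iff[OF n] by auto
    then have pos: "0 < ?a" "0 < ?b" using cube_len_nonneg by (simp_all add: less_le)
    have "0 < cube_max n t" using False ge by simp
    then have "0 < sin (pi * cube_max n t)" using lt by (intro sin_gt_zero) auto
    moreover have "sin (pi * cube_max n t) * ((2 * s i - 1) * ?b) = sin (pi * cube_max n t) * ((2 * t i - 1) * ?a)"
      if "i < n" for i
      using fun_cong[OF eq, of "Suc i"] that pos m by (simp add: cube_to_sphere_eq field_simps)
    ultimately have *: "(2 * s i - 1) * ?b = (2 * t i - 1) * ?a" if "i < n" for i
      using that by (metis less_irrefl mult_left_cancel)
    then have **: "\<bar>2 * s i - 1\<bar> * ?b = \<bar>2 * t i - 1\<bar> * ?a" if "i < n" for i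
      using arg_cong[OF *[OF that], of abs] pos by (simp add: abs_mult)
    \<comment> \<open>At a coordinate where one sup norm is attained, \<open>**\<close> compares it
      with the sup norm of the other point; doing this both ways yields equal Euclidean
      lengths.\<close>
    obtain i1 where i1: "i1 < n" "\<bar>2 * s i1 - 1\<bar> = cube_max n s" using cube_max_attained n by blast
    obtain i2 where i2: "i2 < n" "\<bar>2 * t i2 - 1\<bar> = cube_max n t" using cube_max_attained n by blast
    have "cube_max n t * ?b \<le> cube_max n t * ?a"
      using **[OF i1(1)] i1 m mult_right_mono[OF cube_max_ge[OF i1(1), of t], of ?a] pos by simp
    moreover have "cube_max n t * ?a \<le> cube_max n t * ?b"
      using **[OF i2(1)] i2 m mult_right_mono[OF cube_max_ge[OF i2(1), of s], of ?b] pos by simp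
    ultimately have "?a = ?b" using \<open>0 < cube_max n t\<close> by simp
    with *[OF i] pos show ?thesis by simp
  qed
qed

text \<open>Polar coordinates inverted: arccos of the latitude gives the sup norm m, and the
  remaining coordinates, rescaled from sup norm M to sup norm m, give the direction.\<close>

lemma cube_to_sphere_surj:
  assumes n: "1 \<le> n" and y: "y \<in> unit_sphere n" and y0: "y 0 \<noteq> -1"
  obtains t where "t \<in> interior_cube n" "cube_to_sphere n t = y"
proof -
  define V where "V = sqrt (\<Sum>i<n. (y (Suc i))\<^sup>2)"
  define M where "M = Max ((\<lambda>i. \<bar>y (Suc i)\<bar>) ` {..<n})"
  define m where "m = arccos (y 0) / pi"
  define u where "u i = (if M = 0 then 0 else m * y (Suc i) / M)" for i
  define t where "t i = (if i < n then (u i + 1) / 2 else 0)" for i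
  have V2: "V\<^sup>2 = 1 - (y 0)\<^sup>2" and V: "V = sqrt (1 - (y 0)\<^sup>2)"
    using y by (auto simp: V_def unit_sphere_def sum_nonneg algebra_simps)
  have "(y 0)\<^sup>2 \<le> 1" using V2 zero_le_power2[of V] by linarith
  then have y01: "-1 \<le> y 0" "y 0 \<le> 1" by (auto simp: abs_square_le_1 abs_le_iff)
  have sinV: "sin (pi * m) = V" and cosV: "cos (pi * m) = y 0"
    using y01 by (auto simp: m_def sin_arccos V cos_arccos)
  have "arccos (y 0) < arccos (-1)" using y01 y0 by (intro arccos_less_arccos) auto
  then have m1: "m < 1" by (simp add: m_def)
  have m0: "0 \<le> m" using y01 by (simp add: m_def arccos_lbound)
  have Mge: "\<bar>y (Suc i)\<bar> \<le> M" if "i < n" for i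
    unfolding M_def using that by (intro Max_ge) auto
  have "M \<in> (\<lambda>i. \<bar>y (Suc i)\<bar>) ` {..<n}"
    unfolding M_def using n by (intro Max_in) (auto simp: lessThan_empty_iff)
  then obtain k where k: "k < n" "M = \<bar>y (Suc k)\<bar>" by auto
  have u: "\<bar>u i\<bar> \<le> m" if "i < n" for i
  proof (cases "M = 0")
    case False
    then have "0 < M" using k by simp
    moreover have "m * \<bar>y (Suc i)\<bar> \<le> m * M" using m0 Mge[OF that] by (rule mult_left_mono[rotated])
    ultimately show ?thesis using m0 by (simp add: u_def abs_mult divide_simps)
  qed (use m0 u_def in simp)
  \<comment> \<open>M = 0 leaves only the poles, and y_0 = -1 is excluded; the point e_0 comes from
    the centre of the cube.\<close>
  have Mzero: "V = 0" "m = 0" if "M = 0"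
  proof -
    have "y (Suc i) = 0" if "i < n" for i using Mge[OF that] \<open>M = 0\<close> by simp
    then show "V = 0" by (simp add: V_def)
    with V2 have "(y 0)\<^sup>2 = 1" by simp
    with y0 have "y 0 = 1" by (auto simp: power2_eq_1_iff)
    then show "m = 0" by (simp add: m_def)
  qed
  have 2: "2 * t i - 1 = u i" if "i < n" for i using that by (simp add: t_def field_simps)
  have max: "cube_max n t = m"
  proof (rule cube_max_eqI)
    show "\<bar>2 * t k - 1\<bar> = m"
      using k Mzero m0 2[OF k(1)] by (cases "M = 0") (auto simp: u_def abs_mult)
  qed (use u 2 k in auto)
  have len: "cube_len n t = (if M = 0 then 0 else m * V / M)"
  proof (cases "M = 0")
    case False
    have "(\<Sum>i<n. (2 * t i - 1)\<^sup>2) = (\<Sum>i<n. (m / M)\<^sup>2 * (y (Suc i))\<^sup>2)"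
      using False by (intro sum.cong) (auto simp: 2 u_def power_mult_distrib power_divide)
    also have "\<dots> = (m / M)\<^sup>2 * (\<Sum>i<n. (y (Suc i))\<^sup>2)"
      by (rule sum_distrib_left[symmetric])
    finally have "cube_len n t = sqrt ((m / M)\<^sup>2) * V"
      unfolding cube_len_def V_def by (simp only: real_sqrt_mult)
    with False k m0 show ?thesis by simp
  qed (simp add: cube_len_def 2 u_def)
  have tc: "t \<in> cube_set n"
    using u m1 by (fastforce simp: cube_set_def t_def abs_le_iff)
  with m1 max have "t \<in> interior_cube n" using interior_cube_iff[OF n] by blast
  moreover have "cube_to_sphere n t = y"
  proof
    fix j
    consider "j = 0" | "n < j" | i where "j = Suc i" "i < n"
      by (metis Suc_le_eq not0_implies_Suc not_le)
    then show "cube_to_sphere n t j = y j"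
    proof cases
      case 3
      show ?thesis
      proof (cases "M = 0")
        case True
        with 3 Mge[of i] len show ?thesis by (simp add: cube_to_sphere_eq)
      next
        case False
        have "V \<noteq> 0"
        proof
          assume "V = 0"
          then have "(\<Sum>i<n. (y (Suc i))\<^sup>2) = 0" unfolding V_def by simp
          then have "\<forall>i\<in>{..<n}. (y (Suc i))\<^sup>2 = 0"
            by (subst (asm) sum_nonneg_eq_0_iff) auto
          with k False show False by auto
        qed
        then have "m \<noteq> 0" using sinV by auto
        with False \<open>V \<noteq> 0\<close> 3 len max sinV 2 show ?thesis
          by (simp add: cube_to_sphere_eq u_def)
      qed
    qed (use y max cosV in \<open>auto simp: cube_to_sphere_eq unit_sphere_def\<close>)
  qed
  ultimately show ?thesis by (rule that)
qed

section \<open>The cell structure of the weak join\<close>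

lemma hearring_eq: "hearring n = top_of_set (hearring_set n)"
  unfolding hearring_def Euclidean_space_eq subtopology_subtopology
  by (rule arg_cong2[where f=subtopology]) (auto simp: hearring_set_def hsphere_def)

lemma hsphere_iff_unit_sphere:
  assumes "1 \<le> k"
  shows "r \<in> hsphere n k \<longleftrightarrow> sphere_normalize k r \<in> unit_sphere n"
proof -
  have k: "real k \<noteq> 0" using assms by simp
  have "(r 0 - 1 / real k)\<^sup>2 + (\<Sum>i\<in>{1..n}. (r i)\<^sup>2) = (1 / real k)\<^sup>2
    \<longleftrightarrow> (real k)\<^sup>2 * ((r 0 - 1 / real k)\<^sup>2 + (\<Sum>i\<in>{1..n}. (r i)\<^sup>2)) = (real k)\<^sup>2 * (1 / real k)\<^sup>2"
    using k by simp
  also have "(real k)\<^sup>2 * (1 / real k)\<^sup>2 = 1" using k by (simp add: power_divide)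
  also have "(real k)\<^sup>2 * ((r 0 - 1 / real k)\<^sup>2 + (\<Sum>i\<in>{1..n}. (r i)\<^sup>2))
      = (real k * r 0 - 1)\<^sup>2 + (\<Sum>i<n. (real k * r (Suc i))\<^sup>2)"
  proof -
    have "(real k)\<^sup>2 * (r 0 - 1 / real k)\<^sup>2 = (real k * r 0 - 1)\<^sup>2"
      using k by (simp add: power_mult_distrib[symmetric] right_diff_distrib)
    moreover have "(real k)\<^sup>2 * (\<Sum>i\<in>{1..n}. (r i)\<^sup>2) = (\<Sum>i<n. (real k * r (Suc i))\<^sup>2)"
      by (simp add: sum.atLeast1_atMost_eq sum_distrib_left power_mult_distrib)
    ultimately show ?thesis by (simp add: distrib_left)
  qed
  finally show ?thesis
    using k by (auto simp: hsphere_def unit_sphere_def sphere_normalize_def)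
qed

text \<open>Expanding the square cancels 1/k^2. Hence |r|^2 = 2 r_0 / k: a nonzero point has r_0 > 0
  and determines k.\<close>

lemma hsphere_sum_squares:
  assumes "r \<in> hsphere n k" "1 \<le> k"
  shows "real k * (\<Sum>i\<le>n. (r i)\<^sup>2) = 2 * r 0"
proof -
  have "(\<Sum>i\<le>n. (r i)\<^sup>2) = (r 0)\<^sup>2 + (\<Sum>i\<in>{1..n}. (r i)\<^sup>2)"
    by (simp add: atMost_atLeast0 sum.atLeast_Suc_atMost)
  also have "\<dots> = 2 * r 0 / real k"
  proof -
    have "(r 0)\<^sup>2 - 2 * r 0 * (1 / real k) + (1 / real k)\<^sup>2 + (\<Sum>i\<in>{1..n}. (r i)\<^sup>2) = (1 / real k)\<^sup>2"
      using assms(1) unfolding hsphere_def by (simp add: power2_diff)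
    then show ?thesis by simp
  qed
  finally show ?thesis using assms by simp
qed

lemma sum_squares_pos:
  fixes r :: "nat \<Rightarrow> real"
  assumes "\<And>i. i > n \<Longrightarrow> r i = 0" "r \<noteq> (\<lambda>_. 0)"
  shows "0 < (\<Sum>i\<le>n. (r i)\<^sup>2)"
proof -
  obtain i where i: "r i \<noteq> 0" using assms(2) by auto
  then have "i \<le> n" using assms(1) not_le by blast
  with i show ?thesis by (intro sum_pos2[of _ i]) auto
qed

lemma zero_in_hsphere: "(\<lambda>_. 0) \<in> hsphere n k"
  by (simp add: hsphere_def)

lemma hsphere_index_unique:
  assumes "r \<in> hsphere n k" "r \<in> hsphere n j" "1 \<le> k" "1 \<le> j" "r \<noteq> (\<lambda>_. 0)"
  shows "k = j"
proof -
  have "0 < (\<Sum>i\<le>n. (r i)\<^sup>2)"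
    using assms by (intro sum_squares_pos) (auto simp: hsphere_def)
  moreover have "real k * (\<Sum>i\<le>n. (r i)\<^sup>2) = real j * (\<Sum>i\<le>n. (r i)\<^sup>2)"
    using hsphere_sum_squares assms by metis
  ultimately show ?thesis by simp
qed

text \<open>The bound is the diameter of the sphere; it is uniform in \<open>i\<close>, ready for
  the maximum over coordinates in the product metric.\<close>

lemma hsphere_coord_bound:
  assumes r: "r \<in> hsphere n k" and k: "1 \<le> k"
  shows "\<bar>r i\<bar> \<le> 2 / real k"
proof -
  let ?q = "\<Sum>i\<in>{1..n}. (r i)\<^sup>2"
  have eq: "(r 0 - 1 / real k)\<^sup>2 + ?q = (1 / real k)\<^sup>2" and q: "0 \<le> ?q"
    using r by (auto simp: hsphere_def sum_nonneg)
  have pos: "0 < 1 / real k" using k by simp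
  consider "i = 0" | "1 \<le> i" "i \<le> n" | "n < i" by linarith
  then show ?thesis
  proof cases
    case 1
    have "(r 0 - 1 / real k)\<^sup>2 \<le> (1 / real k)\<^sup>2" using eq q by linarith
    then have "\<bar>r 0 - 1 / real k\<bar> \<le> 1 / real k"
      using pos by (simp only: abs_le_square_iff[symmetric] abs_of_pos)
    with 1 show ?thesis by (simp add: abs_le_iff field_simps)
  next
    case 2
    then have "(r i)\<^sup>2 \<le> ?q" by (intro member_le_sum) auto
    with eq have "(r i)\<^sup>2 \<le> (1 / real k)\<^sup>2" using zero_le_power2[of "r 0 - 1 / real k"] by linarith
    then have "\<bar>r i\<bar> \<le> 1 / real k"
      using pos by (simp only: abs_le_square_iff[symmetric] abs_of_pos)
    also have "\<dots> \<le> 2 / real k" using pos by (simp add: field_simps)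
    finally show ?thesis .
  next
    case 3
    with r pos show ?thesis by (simp add: hsphere_def)
  qed
qed

text \<open>The radii tend to 0. For a fixed n this leaves only finitely many spheres that are not
  contained in a given neighbourhood of the origin, the half of the finiteness condition that
  concerns k.\<close>

lemma small_hspheres:
  assumes "open G" "(\<lambda>_. 0) \<in> G"
  shows "\<exists>K\<ge>1. \<forall>k\<ge>K. hsphere n k \<subseteq> G"
proof -
  obtain e where e: "0 < e" "\<And>y. dist y (\<lambda>_. 0) < e \<Longrightarrow> y \<in> G"
    using assms unfolding open_dist by blast
  obtain N where N: "(1/2::real) ^ N < e / 2"
    using real_arch_pow_inv[of "e / 2" "1/2"] e by auto
  \<comment> \<open>The product distance is at most twice the maximum over the first coordinates
    plus (1/2)^N. The constant 8/e makes 2/k less than e/4, so each of the two summands is below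
    e/2.\<close>
  obtain K :: nat where K: "8 / e < real K" using reals_Archimedean2 by blast
  have "r \<in> G" if k: "max 1 K \<le> k" and r: "r \<in> hsphere n k" for k r
  proof (rule e(2))
    let ?A = "{dist (r (from_nat m)) (0::real) | m::nat. m \<le> N}"
    have A: "?A = (\<lambda>m. dist (r (from_nat m)) 0) ` {..N}" by auto
    have "Max ?A \<le> 2 / real k"
      unfolding A using hsphere_coord_bound[OF r] k by (intro Max.boundedI) auto
    also have "2 / real k < e / 4"
    proof -
      have "8 / e < real k" "0 < real k" using K k by auto
      with e show ?thesis by (simp add: field_simps)
    qed
    finally have "2 * Max ?A < e / 2" by simp
    with N show "dist r (\<lambda>_. 0) < e"
      using dist_fun_le_dist_first_terms[of r "\<lambda>_. 0" N] by linarith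
  qed
  then show ?thesis by (intro exI[of _ "max 1 K"]) auto
qed

text \<open>The inverse of \<open>sphere_normalize k\<close> after the collapse. The formula is kept
  literally as inside \<open>Hinf_concat\<close>, so that it can be folded there.\<close>

definition sphere_chart :: "nat \<Rightarrow> nat \<Rightarrow> (nat \<Rightarrow> real) \<Rightarrow> nat \<Rightarrow> real" where
  "sphere_chart n k s = (\<lambda>i. (cube_to_sphere n s i + (if i = 0 then 1 else 0)) / real k)"

text \<open>The characteristic map of the cell with index (n, k), in the sense of cell
  complexes.\<close>

definition cell :: "nat \<Rightarrow> nat \<Rightarrow> (nat \<Rightarrow> real) \<Rightarrow> nat \<times> (nat \<Rightarrow> real)" where
  "cell n k s = hincl n (sphere_chart n k s)"

lemma sphere_chart_eq_iff:
  "1 \<le> k \<Longrightarrow> sphere_chart n k s = r \<longleftrightarrow> cube_to_sphere n s = sphere_normalize k r"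
  by (auto simp: sphere_chart_def sphere_normalize_def fun_eq_iff field_simps)

lemma sphere_chart_in_hsphere:
  assumes "1 \<le> n" "1 \<le> k"
  shows "sphere_chart n k s \<in> hsphere n k"
  using assms cube_to_sphere_unit[of n s] sphere_chart_eq_iff[of k n s "sphere_chart n k s"]
  by (simp add: hsphere_iff_unit_sphere)

lemma sphere_chart_in_hearring:
  "1 \<le> n \<Longrightarrow> 1 \<le> k \<Longrightarrow> sphere_chart n k s \<in> hearring_set n"
  using sphere_chart_in_hsphere by (auto simp: hearring_set_def)

lemma sphere_chart_boundary:
  "1 \<le> n \<Longrightarrow> s \<in> cube_boundary n \<Longrightarrow> sphere_chart n k s = (\<lambda>_. 0)"
  by (auto simp: sphere_chart_def cube_to_sphere_boundary)

lemma sphere_chart_interior: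
  assumes "1 \<le> n" "1 \<le> k" "s \<in> interior_cube n"
  shows "sphere_chart n k s \<noteq> (\<lambda>_. 0)"
proof
  assume "sphere_chart n k s = (\<lambda>_. 0)"
  from fun_cong[OF this, of 0] have "cube_to_sphere n s 0 = -1"
    using assms by (simp add: sphere_chart_def)
  with cube_to_sphere_interior assms show False by blast
qed

lemma sphere_chart_surj:
  assumes "1 \<le> n" "1 \<le> k" "r \<in> hsphere n k" "r \<noteq> (\<lambda>_. 0)"
  obtains s where "s \<in> interior_cube n" "sphere_chart n k s = r"
proof -
  \<comment> \<open>A point of the sphere with r_0 = 0 would have |r|^2 = 0 by
    \<open>hsphere_sum_squares\<close>, so only the origin is normalized to the pole -e_0.\<close>
  have "sphere_normalize k r 0 \<noteq> -1"
  proof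
    assume "sphere_normalize k r 0 = -1"
    then have "r 0 = 0" using assms by (simp add: sphere_normalize_def)
    with hsphere_sum_squares[OF assms(3,2)] assms(2) have "(\<Sum>i\<le>n. (r i)\<^sup>2) = 0" by simp
    moreover have "0 < (\<Sum>i\<le>n. (r i)\<^sup>2)"
      using assms by (intro sum_squares_pos) (auto simp: hsphere_def)
    ultimately show False by simp
  qed
  then obtain s where "s \<in> interior_cube n" "cube_to_sphere n s = sphere_normalize k r"
    using assms cube_to_sphere_surj[of n "sphere_normalize k r"] hsphere_iff_unit_sphere by metis
  with that sphere_chart_eq_iff assms show ?thesis by blast
qed

lemma continuous_on_sphere_chart: "1 \<le> n \<Longrightarrow> continuous_on S (sphere_chart n k)"
  unfolding sphere_chart_def[abs_def] divide_inverse
  by (rule continuous_on_coordinatewise_then_product)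
     (intro continuous_intros continuous_on_product_then_coordinatewise[OF continuous_on_cube_to_sphere])

lemma compact_cube_set: "compact (cube_set n)"
proof -
  have "cube_set n = Pi\<^sub>E UNIV (\<lambda>i. if i < n then {0..1} else {0})"
    by (auto simp: cube_set_def PiE_iff split: if_splits)
  moreover have "compactin (product_topology (\<lambda>i. euclidean) UNIV)
      (Pi\<^sub>E UNIV (\<lambda>i::nat. if i < n then {0..1::real} else {0}))"
    by (subst compactin_PiE) auto
  ultimately show ?thesis by (simp add: euclidean_product_topology)
qed

lemma zero_in_hearring_set: "(\<lambda>_. 0) \<in> hearring_set n"
  using zero_in_hsphere by (auto simp: hearring_set_def intro: exI[of _ 1])

lemma cell_boundary: "1 \<le> n \<Longrightarrow> s \<in> cube_boundary n \<Longrightarrow> cell n k s = theta"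
  by (simp add: cell_def hincl_def sphere_chart_boundary)

lemma cell_interior:
  "1 \<le> n \<Longrightarrow> 1 \<le> k \<Longrightarrow> s \<in> interior_cube n \<Longrightarrow> cell n k s = (n, sphere_chart n k s)"
  by (simp add: cell_def hincl_def sphere_chart_interior)

lemma cell_neq_theta:
  "1 \<le> n \<Longrightarrow> 1 \<le> k \<Longrightarrow> s \<in> interior_cube n \<Longrightarrow> cell n k s \<noteq> theta"
  by (simp add: cell_interior theta_def)

lemma cube_set_cases:
  assumes "s \<in> cube_set n"
  obtains "s \<in> cube_boundary n" | "s \<in> interior_cube n"
  using assms by (auto simp: interior_cube_def)

text \<open>Only \<open>s\<close> has to be interior: a boundary point \<open>s'\<close> lands in
  \<open>theta\<close>, which no interior point reaches. The dimension is the first component of the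
  pair, k is recovered from the position, and \<open>s\<close> from injectivity of the
  collapse.\<close>

lemma cell_eq_iff:
  assumes "1 \<le> n" "1 \<le> k" "1 \<le> n'" "1 \<le> k'" "s \<in> interior_cube n" "s' \<in> cube_set n'"
  shows "cell n k s = cell n' k' s' \<longleftrightarrow> n = n' \<and> k = k' \<and> s = s'"
proof
  assume eq: "cell n k s = cell n' k' s'"
  with cell_neq_theta[of n k s] cell_boundary assms have s': "s' \<in> interior_cube n'"
    by (metis cube_set_cases)
  with eq assms have n: "n = n'" and r: "sphere_chart n k s = sphere_chart n' k' s'"
    by (auto simp: cell_interior)
  from n have k: "k = k'"
    using hsphere_index_unique[of "sphere_chart n k s" n k k'] assms
      sphere_chart_in_hsphere sphere_chart_interior by (metis r)
  from r n k have "cube_to_sphere n s = cube_to_sphere n s'"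
    using sphere_chart_eq_iff assms by metis
  with n k s' assms show "n = n' \<and> k = k' \<and> s = s'" using cube_to_sphere_inj by blast
qed simp

lemma cell_in_Hinf_set: "1 \<le> n \<Longrightarrow> 1 \<le> k \<Longrightarrow> cell n k s \<in> Hinf_set"
  using sphere_chart_in_hearring by (auto simp: cell_def hincl_def Hinf_set_def)

lemma theta_in_Hinf_set: "theta \<in> Hinf_set"
  by (simp add: Hinf_set_def)

lemma Hinf_set_cases:
  assumes "p \<in> Hinf_set"
  obtains "p = theta"
  | n k s where "1 \<le> n" "1 \<le> k" "s \<in> interior_cube n" "p = cell n k s"
proof (cases "p = theta")
  case False
  with assms obtain n r where p: "p = (n, r)" "1 \<le> n" "r \<in> hearring_set n" "r \<noteq> (\<lambda>_. 0)"
    by (auto simp: Hinf_set_def)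
  then obtain k where k: "1 \<le> k" "r \<in> hsphere n k" by (auto simp: hearring_set_def)
  with p obtain s where "s \<in> interior_cube n" "sphere_chart n k s = r"
    using sphere_chart_surj by blast
  with p k that(2) show ?thesis using cell_interior by metis
qed (use that in blast)

section \<open>Open sets of the weak join in terms of cubes\<close>

lemma openin_Hinf:
  "openin Hinf U \<longleftrightarrow> U \<subseteq> Hinf_set \<and>
      (\<forall>n\<ge>1. openin (hearring n) {r \<in> hearring_set n. hincl n r \<in> U}) \<and>
      (theta \<in> U \<longrightarrow> finite {n. 1 \<le> n \<and> \<not> (hincl n ` hearring_set n \<subseteq> U)})"
    (is "_ = ?L U")
proof -
  have "istopology ?L"
    unfolding istopology_def
  proof (intro conjI allI impI)
    fix S T assume S: "?L S" and T: "?L T"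
    show "S \<inter> T \<subseteq> Hinf_set" using S by auto
    show "openin (hearring n) {r \<in> hearring_set n. hincl n r \<in> S \<inter> T}" if "1 \<le> n" for n
    proof -
      have "{r \<in> hearring_set n. hincl n r \<in> S \<inter> T} =
          {r \<in> hearring_set n. hincl n r \<in> S} \<inter> {r \<in> hearring_set n. hincl n r \<in> T}" by auto
      with S T that show ?thesis by (simp add: openin_Int)
    qed
    show "finite {n. 1 \<le> n \<and> \<not> hincl n ` hearring_set n \<subseteq> S \<inter> T}" if "theta \<in> S \<inter> T"
    proof (rule finite_subset)
      show "finite ({n. 1 \<le> n \<and> \<not> hincl n ` hearring_set n \<subseteq> S} \<union>
                {n. 1 \<le> n \<and> \<not> hincl n ` hearring_set n \<subseteq> T})" using S T that by auto
    qed auto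
  next
    fix \<K> assume K: "\<forall>S\<in>\<K>. ?L S"
    show "\<Union>\<K> \<subseteq> Hinf_set" using K by auto
    show "openin (hearring n) {r \<in> hearring_set n. hincl n r \<in> \<Union>\<K>}" if "1 \<le> n" for n
    proof -
      have "{r \<in> hearring_set n. hincl n r \<in> \<Union>\<K>} = (\<Union>S\<in>\<K>. {r \<in> hearring_set n. hincl n r \<in> S})"
        by auto
      with K that show ?thesis by auto
    qed
    show "finite {n. 1 \<le> n \<and> \<not> hincl n ` hearring_set n \<subseteq> \<Union>\<K>}" if th: "theta \<in> \<Union>\<K>"
    proof -
      obtain S where S: "S \<in> \<K>" "theta \<in> S" using th by auto
      with K have "finite {n. 1 \<le> n \<and> \<not> hincl n ` hearring_set n \<subseteq> S}" by auto
      then show ?thesis by (rule rev_finite_subset) (use S in auto)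
    qed
  qed
  then show ?thesis by (simp add: Hinf_def)
qed

text \<open>The complement in the cube is compact, so its image is closed in the whole function
  space; this carries information from the cubes back to \<open>hearring n\<close>.\<close>

lemma closed_cell_complement:
  assumes "1 \<le> n" "openin (cube n) {s \<in> cube_set n. cell n k s \<in> N}"
  shows "closed (sphere_chart n k ` {s \<in> cube_set n. cell n k s \<notin> N})"
proof -
  have "closedin (cube n) (cube_set n - {s \<in> cube_set n. cell n k s \<in> N})"
    using assms by (metis closedin_def Diff_subset double_diff openin_subset order_refl topspace_cube)
  moreover have "cube_set n - {s \<in> cube_set n. cell n k s \<in> N} = {s \<in> cube_set n. cell n k s \<notin> N}"
    by auto
  ultimately have "closedin (top_of_set (cube_set n)) {s \<in> cube_set n. cell n k s \<notin> N}"
    by (simp add: cube_eq)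
  then have "compact {s \<in> cube_set n. cell n k s \<notin> N}"
    using compact_cube_set closedin_compact by blast
  then show ?thesis
    using assms continuous_on_sphere_chart compact_continuous_image compact_imp_closed by blast
qed

text \<open>On the sphere of radius 1/k the quotient 2 r_0 / |r|^2 equals k, so it separates the spheres.\<close>
lemma openin_hsphere_minus_zero:
  assumes "1 \<le> k"
  shows "openin (top_of_set (hearring_set n)) (hsphere n k - {\<lambda>_. 0})"
proof -
  let ?q = "\<lambda>r::nat \<Rightarrow> real. \<Sum>i\<le>n. (r i)\<^sup>2"
  let ?G = "{r. \<bar>2 * r 0 - real k * ?q r\<bar> < ?q r / 2}"
  have "open ?G"
    by (intro open_Collect_less continuous_intros continuous_on_coord) auto
  moreover have "hsphere n k - {\<lambda>_. 0} = hearring_set n \<inter> ?G"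
  proof (rule Set.set_eqI)
    fix r
    show "r \<in> hsphere n k - {\<lambda>_. 0} \<longleftrightarrow> r \<in> hearring_set n \<inter> ?G"
    proof
      assume r: "r \<in> hsphere n k - {\<lambda>_. 0}"
      then have "0 < ?q r" by (intro sum_squares_pos) (auto simp: hsphere_def)
      with r assms hsphere_sum_squares[of r n k] show "r \<in> hearring_set n \<inter> ?G"
        by (auto simp: hearring_set_def)
    next
      assume r: "r \<in> hearring_set n \<inter> ?G"
      then obtain j where j: "1 \<le> j" "r \<in> hsphere n j" by (auto simp: hearring_set_def)
      have "\<bar>real j * ?q r - real k * ?q r\<bar> < ?q r / 2"
        using r hsphere_sum_squares[OF j(2,1)] by simp
      then have lt: "\<bar>real j - real k\<bar> * \<bar>?q r\<bar> < ?q r / 2"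
        by (simp add: left_diff_distrib[symmetric] abs_mult)
      have "0 \<le> ?q r" by (simp add: sum_nonneg)
      with lt have pos: "0 < ?q r" using not_less by fastforce
      with lt have "\<bar>real j - real k\<bar> * ?q r < 1/2 * ?q r" by simp
      with pos have "\<bar>real j - real k\<bar> < 1/2" by (simp only: mult_less_cancel_right_pos)
      then have "j = k" by linarith
      moreover have "r \<noteq> (\<lambda>_. 0)" using pos by auto
      ultimately show "r \<in> hsphere n k - {\<lambda>_. 0}" using j by simp
    qed
  qed
  ultimately show ?thesis by (auto simp: openin_open)
qed

lemma hearring_chart:
  assumes n: "1 \<le> n" and r: "r \<in> hearring_set n"
  obtains k s where "1 \<le> k" "s \<in> cube_set n" "r = sphere_chart n k s"
proof (cases "r = (\<lambda>_. 0)")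
  case True
  \<comment> \<open>The origin lies on every sphere; the corner 0 of the cube and k = 1 are taken to
    represent it.\<close>
  have "(\<lambda>_. 0) \<in> cube_boundary n" using n by (auto simp: cube_boundary_def cube_set_def intro!: exI[of _ 0])
  with True that[of 1 "\<lambda>_. 0"] sphere_chart_boundary[OF n] cube_boundary_subset show ?thesis
    by (metis le_refl subsetD)
next
  case False
  obtain k where "1 \<le> k" "r \<in> hsphere n k" using r by (auto simp: hearring_set_def)
  with False that show ?thesis
    using sphere_chart_surj[OF n] by (metis DiffD1 interior_cube_def)
qed

text \<open>The weak join condition on n and the smallness of the spheres inside each H^n merge into
  one finiteness condition on pairs (n, k). The way back from cubes to H^n depends on whether
  \<open>theta\<close> belongs to \<open>N\<close>.\<close>

lemma openin_Hinf_cells: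
  "openin Hinf N \<longleftrightarrow> N \<subseteq> Hinf_set \<and>
     (\<forall>n\<ge>1. \<forall>k\<ge>1. openin (cube n) {s \<in> cube_set n. cell n k s \<in> N}) \<and>
     (theta \<in> N \<longrightarrow> finite {(n, k). 1 \<le> n \<and> 1 \<le> k \<and> \<not> cell n k ` cube_set n \<subseteq> N})"
    (is "?L \<longleftrightarrow> ?R")
proof
  assume ?L
  then have N: "N \<subseteq> Hinf_set"
      "\<And>n. 1 \<le> n \<Longrightarrow> openin (top_of_set (hearring_set n)) {r \<in> hearring_set n. hincl n r \<in> N}"
      "theta \<in> N \<Longrightarrow> finite {n. 1 \<le> n \<and> \<not> (hincl n ` hearring_set n \<subseteq> N)}"
    by (auto simp: openin_Hinf hearring_eq)
  have "openin (cube n) {s \<in> cube_set n. cell n k s \<in> N}" if nk: "1 \<le> n" "1 \<le> k" for n k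
  proof -
    have "openin (top_of_set (cube_set n))
       (cube_set n \<inter> sphere_chart n k -` {r \<in> hearring_set n. hincl n r \<in> N})"
      using nk sphere_chart_in_hearring
      by (intro continuous_openin_preimage[OF continuous_on_sphere_chart _ N(2)]) auto
    moreover have "cube_set n \<inter> sphere_chart n k -` {r \<in> hearring_set n. hincl n r \<in> N} =
       {s \<in> cube_set n. cell n k s \<in> N}"
      using nk sphere_chart_in_hearring by (auto simp: cell_def)
    ultimately show ?thesis by (simp add: cube_eq)
  qed
  moreover have "finite {(n, k). 1 \<le> n \<and> 1 \<le> k \<and> \<not> cell n k ` cube_set n \<subseteq> N}" if th: "theta \<in> N"
  proof (rule finite_subset)
    let ?B = "\<lambda>n. {k. 1 \<le> k \<and> \<not> cell n k ` cube_set n \<subseteq> N}"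
    show "{(n, k). 1 \<le> n \<and> 1 \<le> k \<and> \<not> cell n k ` cube_set n \<subseteq> N} \<subseteq>
        Sigma {n. 1 \<le> n \<and> \<not> (hincl n ` hearring_set n \<subseteq> N)} ?B"
      using sphere_chart_in_hearring by (fastforce simp: cell_def)
    show "finite (Sigma {n. 1 \<le> n \<and> \<not> (hincl n ` hearring_set n \<subseteq> N)} ?B)"
    proof (rule finite_SigmaI[OF N(3)[OF th]])
      fix n assume "n \<in> {n. 1 \<le> n \<and> \<not> (hincl n ` hearring_set n \<subseteq> N)}"
      then have n: "1 \<le> n" by simp
      obtain G where G: "open G" "{r \<in> hearring_set n. hincl n r \<in> N} = hearring_set n \<inter> G"
        using N(2)[OF n] by (auto simp: openin_open)
      moreover have "(\<lambda>_. 0) \<in> {r \<in> hearring_set n. hincl n r \<in> N}"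
        using th zero_in_hearring_set by (simp add: hincl_def)
      ultimately have "(\<lambda>_. 0) \<in> G" by blast
      then obtain K where K: "1 \<le> K" "\<And>k. K \<le> k \<Longrightarrow> hsphere n k \<subseteq> G"
        using small_hspheres G by blast
      have "?B n \<subseteq> {..<K}"
      proof
        fix k assume k: "k \<in> ?B n"
        show "k \<in> {..<K}"
        proof (rule ccontr)
          assume "k \<notin> {..<K}"
          then have "hsphere n k \<subseteq> G" using K by simp
          then have "cell n k s \<in> N" for s
            using G(2) k n sphere_chart_in_hsphere[of n k s] sphere_chart_in_hearring[of n k s]
            by (auto simp: cell_def)
          with k show False by auto
        qed
      qed
      then show "finite (?B n)" by (rule finite_subset) simp
    qed
  qed
  ultimately show ?R using N by blast
next
  assume ?R
  then have N: "N \<subseteq> Hinf_set"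
      "\<And>n k. 1 \<le> n \<Longrightarrow> 1 \<le> k \<Longrightarrow> openin (cube n) {s \<in> cube_set n. cell n k s \<in> N}"
      "theta \<in> N \<Longrightarrow> finite {(n, k). 1 \<le> n \<and> 1 \<le> k \<and> \<not> cell n k ` cube_set n \<subseteq> N}"
    by auto
  let ?C = "\<lambda>n k. sphere_chart n k ` {s \<in> cube_set n. cell n k s \<notin> N}"
  have "openin (top_of_set (hearring_set n)) {r \<in> hearring_set n. hincl n r \<in> N}" if n: "1 \<le> n" for n
  proof (cases "theta \<in> N")
    case True
    let ?B = "{k. 1 \<le> k \<and> \<not> cell n k ` cube_set n \<subseteq> N}"
    have "?B = snd ` ({(n, k). 1 \<le> n \<and> 1 \<le> k \<and> \<not> cell n k ` cube_set n \<subseteq> N} \<inter> {n} \<times> UNIV)"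
      using n by force
    then have "finite ?B" using N(3)[OF True] by simp
    \<comment> \<open>Only finitely many closed sets are removed from H^n, so what remains is
      open.\<close>
    then have "closed (\<Union>k\<in>?B. ?C n k)"
      using closed_cell_complement N(2) n by (intro closed_UN) auto
    then have "openin (top_of_set (hearring_set n)) (hearring_set n - (\<Union>k\<in>?B. ?C n k))"
      unfolding Diff_eq by (intro openin_open_Int open_Compl)
    moreover have "hearring_set n - (\<Union>k\<in>?B. ?C n k) = {r \<in> hearring_set n. hincl n r \<in> N}"
    proof (intro equalityI subsetI)
      fix r assume r: "r \<in> hearring_set n - (\<Union>k\<in>?B. ?C n k)"
      then have rH: "r \<in> hearring_set n" by simp
      obtain k s where ks: "1 \<le> k" "s \<in> cube_set n" "r = sphere_chart n k s"
        by (rule hearring_chart[OF n rH])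
      have "cell n k s \<in> N"
      proof (rule ccontr)
        assume "cell n k s \<notin> N"
        with ks have "k \<in> ?B" "r \<in> ?C n k" by auto
        with r show False by blast
      qed
      with rH ks show "r \<in> {r \<in> hearring_set n. hincl n r \<in> N}" by (simp add: cell_def)
    qed (auto simp: cell_def)
    ultimately show ?thesis by simp
  next
    case False
    \<comment> \<open>All k may be exceptional now, and the removed sets may accumulate at the
      origin. Each punctured sphere is open in H^n by itself, so the preimage is assembled sphere by
      sphere.\<close>
    have "openin (top_of_set (hearring_set n)) (hsphere n k - {\<lambda>_. 0} - ?C n k)" if k: "1 \<le> k" for k
    proof -
      have "openin (top_of_set (hearring_set n)) ((hsphere n k - {\<lambda>_. 0}) \<inter> - ?C n k)"
        using closed_cell_complement[OF n N(2)[OF n k]]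
        by (intro openin_Int_open openin_hsphere_minus_zero k open_Compl)
      then show ?thesis by (simp only: Diff_eq)
    qed
    then have "openin (top_of_set (hearring_set n)) (\<Union>k\<in>{1..}. hsphere n k - {\<lambda>_. 0} - ?C n k)"
      by (intro openin_Union) auto
    moreover have "(\<Union>k\<in>{1..}. hsphere n k - {\<lambda>_. 0} - ?C n k) = {r \<in> hearring_set n. hincl n r \<in> N}"
    proof (intro equalityI subsetI)
      fix r assume "r \<in> (\<Union>k\<in>{1..}. hsphere n k - {\<lambda>_. 0} - ?C n k)"
      then obtain k where k: "1 \<le> k" "r \<in> hsphere n k" "r \<noteq> (\<lambda>_. 0)" "r \<notin> ?C n k" by auto
      then obtain s where s: "s \<in> interior_cube n" "sphere_chart n k s = r"
        using sphere_chart_surj n by blast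
      with k have "cell n k s \<in> N" by (auto simp: interior_cube_def)
      with s k show "r \<in> {r \<in> hearring_set n. hincl n r \<in> N}"
        by (auto simp: cell_def hearring_set_def)
    next
      fix r assume r: "r \<in> {r \<in> hearring_set n. hincl n r \<in> N}"
      then obtain k where k: "1 \<le> k" "r \<in> hsphere n k" by (auto simp: hearring_set_def)
      moreover have "r \<noteq> (\<lambda>_. 0)" using r False by (auto simp: hincl_def)
      moreover have "r \<notin> ?C n k" using r by (auto simp: cell_def)
      ultimately show "r \<in> (\<Union>k\<in>{1..}. hsphere n k - {\<lambda>_. 0} - ?C n k)" by auto
    qed
    ultimately show ?thesis by simp
  qed
  moreover have "finite {n. 1 \<le> n \<and> \<not> (hincl n ` hearring_set n \<subseteq> N)}" if "theta \<in> N"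
  proof (rule finite_subset)
    show "finite (fst ` {(n, k). 1 \<le> n \<and> 1 \<le> k \<and> \<not> cell n k ` cube_set n \<subseteq> N})"
      using N(3)[OF that] by simp
    show "{n. 1 \<le> n \<and> \<not> (hincl n ` hearring_set n \<subseteq> N)} \<subseteq>
        fst ` {(n, k). 1 \<le> n \<and> 1 \<le> k \<and> \<not> cell n k ` cube_set n \<subseteq> N}"
    proof
      fix n assume "n \<in> {n. 1 \<le> n \<and> \<not> (hincl n ` hearring_set n \<subseteq> N)}"
      then obtain r where n: "1 \<le> n" and r: "r \<in> hearring_set n" "hincl n r \<notin> N"
        by (auto simp: image_subset_iff)
      obtain k s where "1 \<le> k" "s \<in> cube_set n" "r = sphere_chart n k s"
        by (rule hearring_chart[OF n r(1)])
      with n r show "n \<in> fst ` {(n, k). 1 \<le> n \<and> 1 \<le> k \<and> \<not> cell n k ` cube_set n \<subseteq> N}"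
        by (force simp: cell_def)
    qed
  qed
  ultimately show ?L using N(1) by (simp add: openin_Hinf hearring_eq)
qed

lemma topspace_Hinf [simp]: "topspace Hinf = Hinf_set"
proof
  have "openin Hinf Hinf_set"
    unfolding openin_Hinf_cells
  proof (intro conjI allI impI)
    show "openin (cube n) {s \<in> cube_set n. cell n k s \<in> Hinf_set}" if "1 \<le> n" "1 \<le> k" for n k
      using that openin_topspace[of "cube n"] by (simp add: cell_in_Hinf_set)
    show "finite {(n, k). 1 \<le> n \<and> 1 \<le> k \<and> \<not> cell n k ` cube_set n \<subseteq> Hinf_set}"
      using cell_in_Hinf_set by (auto intro: finite_subset[of _ "{}"])
  qed simp
  then show "Hinf_set \<subseteq> topspace Hinf" by (rule openin_subset)
  show "topspace Hinf \<subseteq> Hinf_set"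
    using openin_topspace[of Hinf] openin_Hinf_cells by blast
qed

lemma continuous_map_cell: "1 \<le> n \<Longrightarrow> 1 \<le> k \<Longrightarrow> continuous_map (cube n) Hinf (cell n k)"
  by (auto simp: continuous_map_def cell_in_Hinf_set openin_Hinf_cells)

lemma openin_interior_cube:
  assumes "1 \<le> n"
  shows "openin (cube n) (interior_cube n)"
proof -
  have "open {s. cube_max n s < 1}"
    by (intro open_Collect_less continuous_on_cube_max continuous_on_const assms)
  moreover have "interior_cube n = cube_set n \<inter> {s. cube_max n s < 1}"
    using interior_cube_iff[OF assms] by auto
  ultimately show ?thesis by (auto simp: cube_eq openin_open)
qed

section \<open>Gluing maps of cubes, with a parameter in a compact space\<close>

definition glue :: "(nat \<Rightarrow> nat \<Rightarrow> 't \<times> (nat \<Rightarrow> real) \<Rightarrow> 'a) \<Rightarrow> 'a \<Rightarrow> 't \<times> nat \<times> (nat \<Rightarrow> real) \<Rightarrow> 'a" where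
  "glue H x0 q = (if snd q = theta then x0
     else (case THE (n, k, s). 1 \<le> n \<and> 1 \<le> k \<and> s \<in> interior_cube n \<and> snd q = cell n k s of
       (n, k, s) \<Rightarrow> H n k (fst q, s)))"

lemma glue_theta [simp]: "glue H x0 (t, theta) = x0"
  by (simp add: glue_def)

text \<open>On interior points the description in \<open>glue\<close> is unique by
  \<open>cell_eq_iff\<close>; on the boundary \<open>bd\<close> makes \<open>H\<close> agree with
  the value x_0 that \<open>glue\<close> assigns to \<open>theta\<close>.\<close>

lemma glue_cell:
  assumes nk: "1 \<le> n" "1 \<le> k" and s: "s \<in> cube_set n"
    and bd: "\<And>s. s \<in> cube_boundary n \<Longrightarrow> H n k (t, s) = x0"
  shows "glue H x0 (t, cell n k s) = H n k (t, s)"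
  using s
proof (cases rule: cube_set_cases)
  case 2
  then have "(THE (n', k', s'). 1 \<le> n' \<and> 1 \<le> k' \<and> s' \<in> interior_cube n' \<and> cell n k s = cell n' k' s') = (n, k, s)"
    using cell_eq_iff[OF nk _ _ 2] nk
    by (intro the_equality) (auto simp: interior_cube_def)
  with 2 show ?thesis using cell_neq_theta[OF nk 2] by (simp add: glue_def)
qed (use bd cell_boundary[OF nk(1)] in simp)

text \<open>A product with a quotient map need not be a quotient map, so continuity is verified with
  explicit product neighbourhoods. Away from \<open>theta\<close> they come from one open cell; at
  \<open>theta\<close> one neighbourhood serves all parameters at once, which is where compactness
  of \<open>K\<close> enters.\<close>

lemma continuous_map_glue:
  assumes K: "compact_space K" and x0: "x0 \<in> topspace X"
    and cont: "\<And>n k. 1 \<le> n \<Longrightarrow> 1 \<le> k \<Longrightarrow> continuous_map (prod_topology K (cube n)) X (H n k)"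
    and bd: "\<And>n k t s. 1 \<le> n \<Longrightarrow> 1 \<le> k \<Longrightarrow> t \<in> topspace K \<Longrightarrow> s \<in> cube_boundary n \<Longrightarrow> H n k (t, s) = x0"
    and fin: "\<And>U. openin X U \<Longrightarrow> x0 \<in> U \<Longrightarrow>
       finite {(n, k). 1 \<le> n \<and> 1 \<le> k \<and> \<not> H n k ` (topspace K \<times> cube_set n) \<subseteq> U}"
  shows "continuous_map (prod_topology K Hinf) X (glue H x0)"
proof -
  have gl: "glue H x0 (t, cell n k s) = H n k (t, s)"
    if "1 \<le> n" "1 \<le> k" "t \<in> topspace K" "s \<in> cube_set n" for n k t s
    by (rule glue_cell[OF that(1,2,4)]) (rule bd[OF that(1,2,3)])
  show ?thesis
    unfolding continuous_map_def
  proof (intro conjI allI impI)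
    show "glue H x0 \<in> topspace (prod_topology K Hinf) \<rightarrow> topspace X"
    proof
      fix q assume "q \<in> topspace (prod_topology K Hinf)"
      then obtain t p where q: "q = (t, p)" "t \<in> topspace K" "p \<in> Hinf_set" by auto
      from q(3) show "glue H x0 q \<in> topspace X"
      proof (cases rule: Hinf_set_cases)
        case (2 n k s)
        then have s: "s \<in> cube_set n" by (simp add: interior_cube_def)
        have "H n k (t, s) \<in> topspace X"
          using continuous_map_funspace[OF cont[OF 2(1,2)]] q s by (auto simp: Pi_iff)
        with gl[OF 2(1,2) q(2) s] q 2 show ?thesis by simp
      qed (use q x0 in simp)
    qed
    fix W assume W: "openin X W"
    have "\<exists>T N. openin K T \<and> openin Hinf N \<and> t0 \<in> T \<and> p0 \<in> N \<and>
        T \<times> N \<subseteq> {q \<in> topspace (prod_topology K Hinf). glue H x0 q \<in> W}"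
      if t0: "t0 \<in> topspace K" and p0: "p0 \<in> Hinf_set" and in_W: "glue H x0 (t0, p0) \<in> W" for t0 p0
      using p0
    proof (cases rule: Hinf_set_cases)
      case 1
      with in_W have x0W: "x0 \<in> W" by simp
      \<comment> \<open>The points whose whole fibre over \<open>K\<close> is mapped into
        \<open>W\<close>; the product of \<open>K\<close> with this set is the required
        neighbourhood.\<close>
      let ?N = "{p \<in> Hinf_set. \<forall>t\<in>topspace K. glue H x0 (t, p) \<in> W}"
      have eq: "{s \<in> cube_set n. cell n k s \<in> ?N} =
          {s \<in> cube_set n. \<forall>t\<in>topspace K. H n k (t, s) \<in> W}" if "1 \<le> n" "1 \<le> k" for n k
        using that gl by (auto simp: cell_in_Hinf_set)
      have "openin (cube n) {s \<in> cube_set n. \<forall>t\<in>topspace K. H n k (t, s) \<in> W}" (is "openin _ ?S")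
        if nk: "1 \<le> n" "1 \<le> k" for n k
      proof (subst openin_subopen, intro ballI)
        fix s assume s: "s \<in> ?S"
        have "openin (prod_topology K (cube n)) {q \<in> topspace (prod_topology K (cube n)). H n k q \<in> W}"
          by (rule openin_continuous_map_preimage[OF cont[OF nk] W])
        moreover have "topspace K \<times> {s} \<subseteq> {q \<in> topspace (prod_topology K (cube n)). H n k q \<in> W}"
          using s by auto
        ultimately have "\<exists>U V. openin K U \<and> openin (cube n) V \<and> topspace K \<subseteq> U \<and> s \<in> V \<and>
          U \<times> V \<subseteq> {q \<in> topspace (prod_topology K (cube n)). H n k q \<in> W}"
          using K s by (intro tube_lemma_left) (simp_all add: compact_space_def)
        then obtain U V where UV: "openin K U" "openin (cube n) V" "topspace K \<subseteq> U" "s \<in> V"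
          "U \<times> V \<subseteq> {q \<in> topspace (prod_topology K (cube n)). H n k q \<in> W}"
          by blast
        then have "V \<subseteq> ?S" using openin_subset[OF UV(2)] by auto
        with UV show "\<exists>T. openin (cube n) T \<and> s \<in> T \<and> T \<subseteq> ?S" by blast
      qed
      moreover have "finite {(n, k). 1 \<le> n \<and> 1 \<le> k \<and> \<not> cell n k ` cube_set n \<subseteq> ?N}"
      proof (rule finite_subset[OF _ fin[OF W x0W]])
        show "{(n, k). 1 \<le> n \<and> 1 \<le> k \<and> \<not> cell n k ` cube_set n \<subseteq> ?N} \<subseteq>
          {(n, k). 1 \<le> n \<and> 1 \<le> k \<and> \<not> H n k ` (topspace K \<times> cube_set n) \<subseteq> W}"
          by (auto simp: image_subset_iff gl cell_in_Hinf_set) blast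
      qed
      ultimately have "openin Hinf ?N"
        unfolding openin_Hinf_cells using eq by auto
      moreover have "p0 \<in> ?N" using 1 x0W theta_in_Hinf_set by simp
      ultimately show ?thesis
        using t0 by (intro exI[of _ "topspace K"] exI[of _ ?N]) auto
    next
      case (2 n0 k0 s0)
      let ?P = "prod_topology K (cube n0)"
      have s0: "s0 \<in> cube_set n0" using 2 by (simp add: interior_cube_def)
      define Q where "Q = {q \<in> topspace ?P. H n0 k0 q \<in> W}"
      have Q: "openin ?P Q"
        unfolding Q_def by (rule openin_continuous_map_preimage[OF cont[OF 2(1,2)] W])
      have "(t0, s0) \<in> Q"
        unfolding Q_def using in_W t0 s0 2 gl by simp
      with Q have "\<exists>T S. openin K T \<and> openin (cube n0) S \<and> t0 \<in> T \<and> s0 \<in> S \<and> T \<times> S \<subseteq> Q"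
        unfolding openin_prod_topology_alt by (elim allE impE)
      then obtain T S where TS: "openin K T" "openin (cube n0) S" "t0 \<in> T" "s0 \<in> S"
         "T \<times> S \<subseteq> Q"
        by (elim exE conjE)
      \<comment> \<open>Cutting down to the open cell keeps \<open>theta\<close> out of
        \<open>?N\<close>, so no finiteness condition arises and the preimages in all other cubes
        are empty.\<close>
      let ?S = "S \<inter> interior_cube n0"
      let ?N = "cell n0 k0 ` ?S"
      have "openin (cube n) {s \<in> cube_set n. cell n k s \<in> ?N}" if nk: "1 \<le> n" "1 \<le> k" for n k
      proof -
        have "{s \<in> cube_set n. cell n k s \<in> ?N} = (if n = n0 \<and> k = k0 then ?S else {})"
          using cell_eq_iff[OF 2(1,2) nk] by (force simp: interior_cube_def)
        with TS openin_interior_cube[OF 2(1)] show ?thesis by (simp add: openin_Int)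
      qed
      moreover have "theta \<notin> ?N" using cell_neq_theta[OF 2(1,2)] by force
      moreover have "?N \<subseteq> Hinf_set" using cell_in_Hinf_set[OF 2(1,2)] by auto
      ultimately have "openin Hinf ?N" unfolding openin_Hinf_cells by blast
      moreover have "T \<times> ?N \<subseteq> {q \<in> topspace (prod_topology K Hinf). glue H x0 q \<in> W}"
        using TS(5)[unfolded Q_def] gl[OF 2(1,2)] cell_in_Hinf_set[OF 2(1,2)] by auto
      moreover have "p0 \<in> ?N" using TS(4) 2 by blast
      ultimately show ?thesis using TS(1,3) by blast
    qed
    then show "openin (prod_topology K Hinf) {q \<in> topspace (prod_topology K Hinf). glue H x0 q \<in> W}"
      unfolding openin_prod_topology_alt by auto
  qed
qed

section \<open>Contracting the small cells\<close>

abbreviation unit_interval :: "real topology" where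
  "unit_interval \<equiv> top_of_set {0..1}"

lemma compact_space_unit_interval: "compact_space unit_interval"
  by (simp add: compact_space_subtopology)

lemma Hinf_maps_theta: "f \<in> Hinf_maps X x0 \<Longrightarrow> f theta = x0"
  by (simp add: Hinf_maps_def)

lemma Hinf_maps_comp_cell:
  assumes "f \<in> Hinf_maps X x0" "1 \<le> n" "1 \<le> k"
  shows "f \<circ> cell n k \<in> pi_maps n X x0"
  using assms continuous_map_compose[OF continuous_map_cell]
  by (auto simp: pi_maps_def Hinf_maps_def cell_boundary)

lemma finite_large_cells:
  assumes f: "f \<in> Hinf_maps X x0" and U: "openin X U" "x0 \<in> U"
  shows "finite {(n, k). 1 \<le> n \<and> 1 \<le> k \<and> \<not> (f \<circ> cell n k) ` cube_set n \<subseteq> U}"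
proof -
  have "openin Hinf {p \<in> topspace Hinf. f p \<in> U}"
    using f U by (intro openin_continuous_map_preimage) (auto simp: Hinf_maps_def)
  then have "finite {(n, k). 1 \<le> n \<and> 1 \<le> k \<and> \<not> cell n k ` cube_set n \<subseteq> {p \<in> topspace Hinf. f p \<in> U}}"
    using f U theta_in_Hinf_set by (simp add: openin_Hinf_cells Hinf_maps_def)
  then show ?thesis
    by (rule rev_finite_subset) auto
qed

lemma Hinf_rel_imp_pi_rel:
  assumes "Hinf_rel X x0 f g" "1 \<le> n" "1 \<le> k"
  shows "pi_rel n X x0 (f \<circ> cell n k) (g \<circ> cell n k)"
  using assms(1) unfolding Hinf_rel_def pi_rel_def
  by (rule homotopic_with_compose_continuous_map_right)
     (use assms in \<open>auto simp: continuous_map_cell cell_boundary\<close>)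

lemma Hinf_rel_refl: "f \<in> Hinf_maps X x0 \<Longrightarrow> Hinf_rel X x0 f f"
  by (auto simp: Hinf_rel_def Hinf_maps_def)

lemma Hinf_rel_sym: "Hinf_rel X x0 f g \<Longrightarrow> Hinf_rel X x0 g f"
  unfolding Hinf_rel_def by (rule homotopic_with_symD)

lemma Hinf_rel_trans: "Hinf_rel X x0 f g \<Longrightarrow> Hinf_rel X x0 g h \<Longrightarrow> Hinf_rel X x0 f h"
  unfolding Hinf_rel_def by (rule homotopic_with_trans)

lemma Hinf_eqI:
  assumes "f theta = g theta"
    and "\<And>n k s. \<lbrakk>1 \<le> n; 1 \<le> k; s \<in> cube_set n\<rbrakk> \<Longrightarrow> f (cell n k s) = g (cell n k s)"
    and "p \<in> Hinf_set"
  shows "f p = g p"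
  using assms(3)
proof (cases rule: Hinf_set_cases)
  case (2 n k s)
  then show ?thesis using assms(2)[of n k s] by (simp add: interior_cube_def)
qed (use assms in simp)

text \<open>\<open>fin\<close> expresses continuity at \<open>theta\<close>, uniformly in the
  homotopy parameter.\<close>

lemma Hinf_rel_glue:
  assumes x0: "x0 \<in> topspace X" and f: "f theta = x0" and g: "g theta = x0"
    and cont: "\<And>n k. 1 \<le> n \<Longrightarrow> 1 \<le> k \<Longrightarrow> continuous_map (prod_topology unit_interval (cube n)) X (H n k)"
    and bd: "\<And>n k t s. 1 \<le> n \<Longrightarrow> 1 \<le> k \<Longrightarrow> t \<in> {0..1} \<Longrightarrow> s \<in> cube_boundary n \<Longrightarrow> H n k (t, s) = x0"
    and fin: "\<And>U. openin X U \<Longrightarrow> x0 \<in> U \<Longrightarrow>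
       finite {(n, k). 1 \<le> n \<and> 1 \<le> k \<and> \<not> H n k ` ({0..1} \<times> cube_set n) \<subseteq> U}"
    and H0: "\<And>n k s. 1 \<le> n \<Longrightarrow> 1 \<le> k \<Longrightarrow> s \<in> cube_set n \<Longrightarrow> H n k (0, s) = f (cell n k s)"
    and H1: "\<And>n k s. 1 \<le> n \<Longrightarrow> 1 \<le> k \<Longrightarrow> s \<in> cube_set n \<Longrightarrow> H n k (1, s) = g (cell n k s)"
  shows "Hinf_rel X x0 f g"
proof -
  have "continuous_map (prod_topology unit_interval Hinf) X (glue H x0)"
    using compact_space_unit_interval x0 cont
    by (rule continuous_map_glue) (simp_all only: topspace_euclidean_subtopology bd fin)
  moreover have "glue H x0 (0, p) = f p" if "p \<in> Hinf_set" for p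
  proof (rule Hinf_eqI[OF _ _ that])
    fix n k :: nat and s assume *: "1 \<le> n" "1 \<le> k" "s \<in> cube_set n"
    have "glue H x0 (0, cell n k s) = H n k (0, s)"
      using * by (rule glue_cell) (rule bd, use * in auto)
    then show "glue H x0 (0, cell n k s) = f (cell n k s)" using * H0 by simp
  qed (simp add: f)
  moreover have "glue H x0 (1, p) = g p" if "p \<in> Hinf_set" for p
  proof (rule Hinf_eqI[OF _ _ that])
    fix n k :: nat and s assume *: "1 \<le> n" "1 \<le> k" "s \<in> cube_set n"
    have "glue H x0 (1, cell n k s) = H n k (1, s)"
      using * by (rule glue_cell) (rule bd, use * in auto)
    then show "glue H x0 (1, cell n k s) = g (cell n k s)" using * H1 by simp
  qed (simp add: g)
  ultimately show ?thesis
    unfolding Hinf_rel_def using theta_in_Hinf_set by (subst homotopic_with) auto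
qed

text \<open>The time-independent family, \<open>c n k\<close> after \<open>snd\<close>, is glued to
  a homotopy from \<open>f\<close> to itself, and \<open>homotopic_with\<close> contains the
  continuity of its ends.\<close>

lemma Hinf_map_from_cells:
  assumes x0: "x0 \<in> topspace X"
    and c: "\<And>n k. 1 \<le> n \<Longrightarrow> 1 \<le> k \<Longrightarrow> c n k \<in> pi_maps n X x0"
    and fin: "\<And>U. openin X U \<Longrightarrow> x0 \<in> U \<Longrightarrow>
       finite {(n, k). 1 \<le> n \<and> 1 \<le> k \<and> \<not> c n k ` cube_set n \<subseteq> U}"
    and f: "f theta = x0" "\<And>n k s. 1 \<le> n \<Longrightarrow> 1 \<le> k \<Longrightarrow> s \<in> cube_set n \<Longrightarrow> f (cell n k s) = c n k s"
  shows "f \<in> Hinf_maps X x0"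
proof -
  have "Hinf_rel X x0 f f"
  proof (rule Hinf_rel_glue[OF x0, where H = "\<lambda>n k. c n k \<circ> snd"])
    show "continuous_map (prod_topology unit_interval (cube n)) X (c n k \<circ> snd)"
      if "1 \<le> n" "1 \<le> k" for n k
      using c[OF that] by (intro continuous_map_compose[OF continuous_map_snd]) (simp add: pi_maps_def)
    show "(c n k \<circ> snd) (t, s) = x0" if "1 \<le> n" "1 \<le> k" "s \<in> cube_boundary n" for n k s and t :: real
      using c[OF that(1,2)] that by (simp add: pi_maps_def)
    show "finite {(n, k). 1 \<le> n \<and> 1 \<le> k \<and> \<not> (c n k \<circ> snd) ` ({0..1::real} \<times> cube_set n) \<subseteq> U}"
      if "openin X U" "x0 \<in> U" for U
      using fin[OF that] by (rule rev_finite_subset) auto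
  qed (simp_all add: f)
  then show ?thesis
    unfolding Hinf_rel_def Hinf_maps_def by simp
qed

lemma exists_Hinf_map:
  assumes x0: "x0 \<in> topspace X"
    and c: "\<And>n k. 1 \<le> n \<Longrightarrow> 1 \<le> k \<Longrightarrow> c n k \<in> pi_maps n X x0"
    and fin: "\<And>U. openin X U \<Longrightarrow> x0 \<in> U \<Longrightarrow>
       finite {(n, k). 1 \<le> n \<and> 1 \<le> k \<and> \<not> c n k ` cube_set n \<subseteq> U}"
  obtains f where "f \<in> Hinf_maps X x0"
    "\<And>n k s. 1 \<le> n \<Longrightarrow> 1 \<le> k \<Longrightarrow> s \<in> cube_set n \<Longrightarrow> f (cell n k s) = c n k s"
proof -
  \<comment> \<open>The parameter 0 is a dummy: the family ignores its first component.\<close>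
  define f where "f p = glue (\<lambda>n k q. c n k (snd q)) x0 (0 :: real, p)" for p
  have f: "f (cell n k s) = c n k s" if "1 \<le> n" "1 \<le> k" "s \<in> cube_set n" for n k s
    unfolding f_def using that c[OF that(1,2)] by (subst glue_cell) (auto simp: pi_maps_def)
  have "f \<in> Hinf_maps X x0"
    by (rule Hinf_map_from_cells[OF x0 c fin _ f]) (simp_all add: f_def)
  with f that show ?thesis by blast
qed

text \<open>The two \<open>THE\<close> descriptions in \<open>Hinf_concat\<close> recover k and
  \<open>s\<close> at an interior point. A boundary point stays on the boundary when coordinate 0 is
  rescaled, so there both sides are x_0.\<close>

lemma Hinf_concat_cell:
  assumes f: "f theta = x0" and g: "g theta = x0"
    and nk: "1 \<le> n" "1 \<le> k" and s: "s \<in> cube_set n"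
  shows "Hinf_concat f g x0 (cell n k s) = cube_concat (f \<circ> cell n k) (g \<circ> cell n k) s"
  using s
proof (cases rule: cube_set_cases)
  case 1
  have "f (cell n k t) = x0" "g (cell n k t) = x0" if "t \<in> cube_boundary n" for t
    using f g cell_boundary[OF nk(1) that] by auto
  moreover have "(if s 0 \<le> 1/2 then s(0 := 2 * s 0) else s(0 := 2 * s 0 - 1)) \<in> cube_boundary n"
    using 1 nk cube_coord0[OF s nk(1)] by (auto intro!: cube_boundary_update)
  ultimately show ?thesis
    using 1 nk by (auto simp: Hinf_concat_def cube_concat_def cell_boundary split: if_splits)
next
  case 2
  let ?r = "sphere_chart n k s"
  have k: "(THE j. 1 \<le> j \<and> ?r \<in> hsphere n j) = k"
    using hsphere_index_unique sphere_chart_in_hsphere[OF nk] sphere_chart_interior[OF nk 2] nk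
    by (intro the_equality) blast+
  have t: "(THE t. t \<in> interior_cube n \<and> cube_to_sphere n t = sphere_normalize k ?r) = s"
    using sphere_chart_eq_iff[OF nk(2), of n s ?r] cube_to_sphere_inj[OF nk(1)] 2
    by (intro the_equality) auto
  have "cell n k s = (n, ?r)" "(n, ?r) \<noteq> theta"
    using cell_interior[OF nk 2] cell_neq_theta[OF nk 2] by auto
  then show ?thesis
    by (simp add: Hinf_concat_def Let_def k t comp_def cell_def sphere_chart_def[symmetric] del: One_nat_def)
qed

lemma Hinf_concat_in_Hinf_maps:
  assumes x0: "x0 \<in> topspace X" and f: "f \<in> Hinf_maps X x0" and g: "g \<in> Hinf_maps X x0"
  shows "Hinf_concat f g x0 \<in> Hinf_maps X x0"
proof (rule Hinf_map_from_cells[OF x0, where c = "\<lambda>n k. cube_concat (f \<circ> cell n k) (g \<circ> cell n k)"])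
  show "cube_concat (f \<circ> cell n k) (g \<circ> cell n k) \<in> pi_maps n X x0" if "1 \<le> n" "1 \<le> k" for n k
    by (intro cube_concat_in_pi_maps Hinf_maps_comp_cell f g that)
  show "finite {(n, k). 1 \<le> n \<and> 1 \<le> k \<and> \<not> cube_concat (f \<circ> cell n k) (g \<circ> cell n k) ` cube_set n \<subseteq> U}"
    if U: "openin X U" "x0 \<in> U" for U
  proof (rule finite_subset[OF _ finite_UnI[OF finite_large_cells[OF f U] finite_large_cells[OF g U]]])
    have "cube_concat u v ` cube_set n \<subseteq> U" if "u ` cube_set n \<subseteq> U" "v ` cube_set n \<subseteq> U" "1 \<le> n"
      for n and u v :: "(nat \<Rightarrow> real) \<Rightarrow> 'a"
    proof (intro image_subsetI)
      fix s assume s: "s \<in> cube_set n"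
      have "s 0 \<le> 1/2 \<Longrightarrow> s(0 := 2 * s 0) \<in> cube_set n" "\<not> s 0 \<le> 1/2 \<Longrightarrow> s(0 := 2 * s 0 - 1) \<in> cube_set n"
        using s cube_coord0[OF s that(3)] that(3) by (auto intro!: cube_set_update)
      with that show "cube_concat u v s \<in> U"
        unfolding cube_concat_def by (simp add: image_subset_iff)
    qed
    then show "{(n, k). 1 \<le> n \<and> 1 \<le> k \<and> \<not> cube_concat (f \<circ> cell n k) (g \<circ> cell n k) ` cube_set n \<subseteq> U}
       \<subseteq> {(n, k). 1 \<le> n \<and> 1 \<le> k \<and> \<not> (f \<circ> cell n k) ` cube_set n \<subseteq> U} \<union>
          {(n, k). 1 \<le> n \<and> 1 \<le> k \<and> \<not> (g \<circ> cell n k) ` cube_set n \<subseteq> U}"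
      by blast
  qed
  show "Hinf_concat f g x0 theta = x0" by (simp add: Hinf_concat_def)
qed (use f g in \<open>simp add: Hinf_concat_cell Hinf_maps_theta\<close>)

lemma pi_rel_Hinf_concat_cell:
  assumes x0: "x0 \<in> topspace X" and f: "f \<in> Hinf_maps X x0" and g: "g \<in> Hinf_maps X x0"
    and nk: "1 \<le> n" "1 \<le> k"
  shows "pi_rel n X x0 (Hinf_concat f g x0 \<circ> cell n k) (cube_concat (f \<circ> cell n k) (g \<circ> cell n k))"
  using f g nk
  by (intro pi_rel_equal Hinf_maps_comp_cell Hinf_concat_in_Hinf_maps x0)
     (simp_all add: Hinf_concat_cell Hinf_maps_theta)

text \<open>\<open>c\<close> contracts V inside X. Its two ends are prescribed for all
  \<open>x\<close>, as in \<open>homotopic_with\<close>, and \<open>c_x0\<close> is the relative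
  condition.\<close>

locale contracting_nbhd =
  fixes X :: "'a topology" and x0 :: 'a and V :: "'a set" and c :: "real \<times> 'a \<Rightarrow> 'a"
  assumes open_V: "openin X V" and x0_in_V: "x0 \<in> V"
    and cont_c: "continuous_map (prod_topology unit_interval (subtopology X V)) X c"
    and c_0: "c (0, x) = x" and c_1: "c (1, x) = x0"
    and c_x0: "t \<in> {0..1} \<Longrightarrow> c (t, x0) = x0"
begin

lemma x0_in_topspace: "x0 \<in> topspace X"
  using open_V x0_in_V openin_subset by blast

definition large_cells :: "(nat \<times> (nat \<Rightarrow> real) \<Rightarrow> 'a) \<Rightarrow> (nat \<times> nat) set" where
  "large_cells f = {(n, k). 1 \<le> n \<and> 1 \<le> k \<and> \<not> (f \<circ> cell n k) ` cube_set n \<subseteq> V}"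

lemma finite_large_cells_V: "f \<in> Hinf_maps X x0 \<Longrightarrow> finite (large_cells f)"
  unfolding large_cells_def using open_V x0_in_V by (intro finite_large_cells)

text \<open>\<open>c\<close> sends the compact set [0, 1] x {x_0} to x_0, which lies in U, so a
  whole tube around it goes into U. Points near x_0 thus stay in U during the contraction.\<close>

lemma contraction_tube:
  assumes U: "openin X U" "x0 \<in> U"
  obtains W where "openin X W" "x0 \<in> W" "W \<subseteq> V" "c ` ({0..1} \<times> W) \<subseteq> U"
proof -
  let ?P = "prod_topology unit_interval (subtopology X V)"
  have top: "topspace (subtopology X V) = V" using open_V openin_subset by auto
  have "openin ?P {q \<in> topspace ?P. c q \<in> U}"
    by (rule openin_continuous_map_preimage[OF cont_c U(1)])
  then have "\<exists>S W. openin unit_interval S \<and> openin (subtopology X V) W \<and> {0..1} \<subseteq> S \<and> x0 \<in> W \<and>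
      S \<times> W \<subseteq> {q \<in> topspace ?P. c q \<in> U}"
    using x0_in_V U(2) c_x0 top
    by (intro tube_lemma_left) (auto simp: compactin_subtopology)
  then obtain S W where SW: "openin (subtopology X V) W" "{0..1} \<subseteq> S" "x0 \<in> W"
      "S \<times> W \<subseteq> {q \<in> topspace ?P. c q \<in> U}"
    by blast
  have "openin X W" "W \<subseteq> V"
    using SW(1) open_V openin_open_subtopology by blast+
  moreover have "c ` ({0..1} \<times> W) \<subseteq> U" using SW(2,4) by auto
  ultimately show ?thesis using that SW(3) by blast
qed

text \<open>\<open>F\<close> may exceed \<open>large_cells f\<close>, so that two maps can be made
  constant off the same set. The homotopy rests on the cells in \<open>F\<close> and follows
  \<open>c\<close> on all others.\<close>

lemma Hinf_rel_restrict:
  assumes f: "f \<in> Hinf_maps X x0" and F: "finite F" "large_cells f \<subseteq> F"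
  obtains f' where "f' \<in> Hinf_maps X x0" "Hinf_rel X x0 f f'"
    "\<And>n k s. \<lbrakk>1 \<le> n; 1 \<le> k; s \<in> cube_set n\<rbrakk> \<Longrightarrow>
       f' (cell n k s) = (if (n, k) \<in> F then f (cell n k s) else x0)"
proof -
  let ?d = "\<lambda>n k. if (n, k) \<in> F then f \<circ> cell n k else (\<lambda>_. x0)"
  obtain f' where f': "f' \<in> Hinf_maps X x0"
    "\<And>n k s. \<lbrakk>1 \<le> n; 1 \<le> k; s \<in> cube_set n\<rbrakk> \<Longrightarrow> f' (cell n k s) = ?d n k s"
  proof (rule exists_Hinf_map[OF x0_in_topspace, where c = ?d])
    show "?d n k \<in> pi_maps n X x0" if "1 \<le> n" "1 \<le> k" for n k
      using that f Hinf_maps_comp_cell const_in_pi_maps x0_in_topspace by auto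
    show "finite {(n, k). 1 \<le> n \<and> 1 \<le> k \<and> \<not> ?d n k ` cube_set n \<subseteq> U}"
      if "openin X U" "x0 \<in> U" for U
      using F(1) by (rule rev_finite_subset) (use that in auto)
  qed blast
  let ?H = "\<lambda>n k q. if (n, k) \<in> F then f (cell n k (snd q)) else c (fst q, f (cell n k (snd q)))"
  have "Hinf_rel X x0 f f'"
  proof (rule Hinf_rel_glue[OF x0_in_topspace, where H = ?H])
    show "f theta = x0" "f' theta = x0" using f f' by (simp_all add: Hinf_maps_theta)
    show "continuous_map (prod_topology unit_interval (cube n)) X (?H n k)"
      if nk: "1 \<le> n" "1 \<le> k" for n k
    proof -
      let ?P = "prod_topology unit_interval (cube n)"
      have fc: "continuous_map (cube n) X (f \<circ> cell n k)"
        using Hinf_maps_comp_cell[OF f nk] by (simp add: pi_maps_def)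
      from continuous_map_compose[OF continuous_map_snd fc]
      have fs: "continuous_map ?P X (\<lambda>q. f (cell n k (snd q)))"
        by (simp add: o_def)
      show ?thesis
      proof (cases "(n, k) \<in> F")
        case False
        with F(2) nk have "(f \<circ> cell n k) ` cube_set n \<subseteq> V"
          by (auto simp: large_cells_def)
        then have "continuous_map ?P (subtopology X V) (\<lambda>q. f (cell n k (snd q)))"
          using fs by (auto simp: continuous_map_in_subtopology)
        then have "continuous_map ?P (prod_topology unit_interval (subtopology X V))
            (\<lambda>q. (fst q, f (cell n k (snd q))))"
          by (intro continuous_map_pairedI continuous_map_fst)
        from continuous_map_compose[OF this cont_c] False show ?thesis by (simp add: o_def)
      qed (use fs in simp)
    qed
    show "?H n k (t, s) = x0" if "1 \<le> n" "1 \<le> k" "t \<in> {0..1}" "s \<in> cube_boundary n" for n k t s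
      using that f by (simp add: cell_boundary Hinf_maps_theta c_x0)
    show "finite {(n, k). 1 \<le> n \<and> 1 \<le> k \<and> \<not> ?H n k ` ({0..1} \<times> cube_set n) \<subseteq> U}"
      if U: "openin X U" "x0 \<in> U" for U
    proof -
      \<comment> \<open>A cell outside \<open>F\<close> whose image lies in \<open>W\<close> stays
        in \<open>U\<close> throughout, and all but finitely many cells have their image in
        \<open>W\<close>.\<close>
      obtain W where W: "openin X W" "x0 \<in> W" "W \<subseteq> V" "c ` ({0..1} \<times> W) \<subseteq> U"
        using contraction_tube[OF U] by blast
      have "finite (F \<union> {(n, k). 1 \<le> n \<and> 1 \<le> k \<and> \<not> (f \<circ> cell n k) ` cube_set n \<subseteq> W})"
        using F finite_large_cells[OF f W(1,2)] by simp
      then show ?thesis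
        by (rule rev_finite_subset) (use W(4) in \<open>auto simp: image_subset_iff\<close>)
    qed
  qed (simp_all add: f'(2) c_0 c_1)
  with f' that show ?thesis by auto
qed

text \<open>A sphere mapped into V is null-homotopic, because \<open>Hinf_rel_restrict\<close>
  replaces the map on it by the constant one.\<close>

lemma finite_nontrivial_cells:
  assumes f: "f \<in> Hinf_maps X x0"
  shows "finite {(n, k). 1 \<le> n \<and> 1 \<le> k \<and> \<not> pi_rel n X x0 (f \<circ> cell n k) (\<lambda>_. x0)}"
proof (rule finite_subset[OF _ finite_large_cells_V[OF f]], clarify, rule ccontr)
  fix n k assume nk: "1 \<le> n" "1 \<le> k" and *: "\<not> pi_rel n X x0 (f \<circ> cell n k) (\<lambda>_. x0)" "(n, k) \<notin> large_cells f"
  obtain f' where f': "f' \<in> Hinf_maps X x0" "Hinf_rel X x0 f f'"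
    "\<And>n k s. \<lbrakk>1 \<le> n; 1 \<le> k; s \<in> cube_set n\<rbrakk> \<Longrightarrow>
       f' (cell n k s) = (if (n, k) \<in> large_cells f then f (cell n k s) else x0)"
    using Hinf_rel_restrict[OF f finite_large_cells_V[OF f] order_refl] by blast
  have "pi_rel n X x0 (f' \<circ> cell n k) (\<lambda>_. x0)"
    using f' nk * by (intro pi_rel_equal Hinf_maps_comp_cell) auto
  with Hinf_rel_imp_pi_rel[OF f'(2) nk] have "pi_rel n X x0 (f \<circ> cell n k) (\<lambda>_. x0)"
    by (rule pi_rel_trans)
  with * show False by simp
qed

text \<open>Completeness of the invariant. Cellwise homotopies come without any bound on their size,
  so \<open>f\<close> and \<open>g\<close> are first made constant off the common finite set
  \<open>?F\<close>; then any choice on the cells in \<open>?F\<close> glues.\<close>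

lemma pi_rel_imp_Hinf_rel:
  assumes f: "f \<in> Hinf_maps X x0" and g: "g \<in> Hinf_maps X x0"
    and rel: "\<And>n k. 1 \<le> n \<Longrightarrow> 1 \<le> k \<Longrightarrow> pi_rel n X x0 (f \<circ> cell n k) (g \<circ> cell n k)"
  shows "Hinf_rel X x0 f g"
proof -
  let ?F = "large_cells f \<union> large_cells g"
  have fin: "finite ?F" using f g finite_large_cells_V by blast
  obtain f' where f': "f' \<in> Hinf_maps X x0" "Hinf_rel X x0 f f'"
    "\<And>n k s. \<lbrakk>1 \<le> n; 1 \<le> k; s \<in> cube_set n\<rbrakk> \<Longrightarrow>
       f' (cell n k s) = (if (n, k) \<in> ?F then f (cell n k s) else x0)"
    using Hinf_rel_restrict[OF f fin] by blast
  obtain g' where g': "g' \<in> Hinf_maps X x0" "Hinf_rel X x0 g g'"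
    "\<And>n k s. \<lbrakk>1 \<le> n; 1 \<le> k; s \<in> cube_set n\<rbrakk> \<Longrightarrow>
       g' (cell n k s) = (if (n, k) \<in> ?F then g (cell n k s) else x0)"
    using Hinf_rel_restrict[OF g fin] by blast
  \<comment> \<open>The premises on n and k are moved under the existential quantifier, so that one
    function \<open>h\<close> can be chosen for all indices.\<close>
  have "\<exists>h. 1 \<le> n \<longrightarrow> 1 \<le> k \<longrightarrow> continuous_map (prod_topology unit_interval (cube n)) X h \<and>
     (\<forall>s\<in>cube_set n. h (0, s) = f (cell n k s)) \<and> (\<forall>s\<in>cube_set n. h (1, s) = g (cell n k s)) \<and>
     (\<forall>t\<in>{0..1}. \<forall>s\<in>cube_boundary n. h (t, s) = x0)" for n k
    using rel[of n k] unfolding pi_rel_iff by auto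
  then obtain h where h: "\<And>n k. 1 \<le> n \<Longrightarrow> 1 \<le> k \<Longrightarrow>
     continuous_map (prod_topology unit_interval (cube n)) X (h n k) \<and>
     (\<forall>s\<in>cube_set n. h n k (0, s) = f (cell n k s)) \<and> (\<forall>s\<in>cube_set n. h n k (1, s) = g (cell n k s)) \<and>
     (\<forall>t\<in>{0..1}. \<forall>s\<in>cube_boundary n. h n k (t, s) = x0)"
    by metis
  let ?H = "\<lambda>n k. if (n, k) \<in> ?F then h n k else (\<lambda>_. x0)"
  have "Hinf_rel X x0 f' g'"
  proof (rule Hinf_rel_glue[OF x0_in_topspace, where H = ?H])
    show "f' theta = x0" "g' theta = x0" using f' g' by (simp_all add: Hinf_maps_theta)
    show "continuous_map (prod_topology unit_interval (cube n)) X (?H n k)" if "1 \<le> n" "1 \<le> k" for n k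
      using h[OF that] x0_in_topspace by auto
    show "?H n k (t, s) = x0" if "1 \<le> n" "1 \<le> k" "t \<in> {0..1}" "s \<in> cube_boundary n" for n k t s
      using h[OF that(1,2)] that by auto
    show "finite {(n, k). 1 \<le> n \<and> 1 \<le> k \<and> \<not> ?H n k ` ({0..1} \<times> cube_set n) \<subseteq> U}"
      if "openin X U" "x0 \<in> U" for U
      using fin by (rule rev_finite_subset) (use that in auto)
  qed (use h in \<open>simp_all add: f'(3) g'(3)\<close>)
  from Hinf_rel_trans[OF f'(2) Hinf_rel_trans[OF this Hinf_rel_sym[OF g'(2)]]] show ?thesis .
qed

text \<open>Congruence is checked cell by cell: both concatenations restrict to
  \<open>cube_concat\<close> up to homotopy, and \<open>pi_rel_imp_Hinf_rel\<close> reassembles the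
  result.\<close>

lemma hclass_mult_Hinf:
  "hclass_mult (Hinf_maps X x0) (Hinf_rel X x0) (\<lambda>f g. Hinf_concat f g x0)"
proof
  show "Hinf_rel X x0 f h" if "Hinf_rel X x0 f g" "Hinf_rel X x0 g h" for f g h
    using that by (rule Hinf_rel_trans)
  show closed: "Hinf_concat f g x0 \<in> Hinf_maps X x0"
    if "f \<in> Hinf_maps X x0" "g \<in> Hinf_maps X x0" for f g
    using x0_in_topspace that by (rule Hinf_concat_in_Hinf_maps)
  show "Hinf_rel X x0 (Hinf_concat f g x0) (Hinf_concat f' g' x0)"
    if m: "f \<in> Hinf_maps X x0" "f' \<in> Hinf_maps X x0" "g \<in> Hinf_maps X x0" "g' \<in> Hinf_maps X x0"
      and r: "Hinf_rel X x0 f f'" "Hinf_rel X x0 g g'" for f f' g g'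
  proof (rule pi_rel_imp_Hinf_rel)
    fix n k :: nat assume nk: "1 \<le> n" "1 \<le> k"
    show "pi_rel n X x0 (Hinf_concat f g x0 \<circ> cell n k) (Hinf_concat f' g' x0 \<circ> cell n k)"
      by (rule pi_rel_trans[OF pi_rel_Hinf_concat_cell[OF x0_in_topspace m(1,3) nk]],
          rule pi_rel_trans[OF _ pi_rel_sym[OF pi_rel_Hinf_concat_cell[OF x0_in_topspace m(2,4) nk]]],
          rule pi_rel_cube_concat[OF Hinf_rel_imp_pi_rel[OF r(1) nk] Hinf_rel_imp_pi_rel[OF r(2) nk] nk(1)])
  qed (use closed m in auto)
qed (fact Hinf_rel_refl Hinf_rel_sym)+

section \<open>The isomorphism onto the weak product\<close>

abbreviation pi_class :: "nat \<Rightarrow> ((nat \<Rightarrow> real) \<Rightarrow> 'a) \<Rightarrow> ((nat \<Rightarrow> real) \<Rightarrow> 'a) set" where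
  "pi_class n \<equiv> hclass (pi_maps n X x0) (pi_rel n X x0)"

abbreviation Hinf_class :: "(nat \<times> (nat \<Rightarrow> real) \<Rightarrow> 'a) \<Rightarrow> (nat \<times> (nat \<Rightarrow> real) \<Rightarrow> 'a) set" where
  "Hinf_class \<equiv> hclass (Hinf_maps X x0) (Hinf_rel X x0)"

abbreviation weak_product :: "(nat \<Rightarrow> nat \<Rightarrow> ((nat \<Rightarrow> real) \<Rightarrow> 'a) set) monoid" where
  "weak_product \<equiv> sum_group {1..} (\<lambda>n. sum_group {1..} (\<lambda>k. pi_group n X x0))"

text \<open>Restriction on both levels gives the extensional functions that form the carrier of
  \<open>sum_group\<close>; the choice of representative is immaterial by
  \<open>cell_classes_Hinf_class\<close>.\<close>

definition cell_classes ::
  "(nat \<times> (nat \<Rightarrow> real) \<Rightarrow> 'a) set \<Rightarrow> nat \<Rightarrow> nat \<Rightarrow> ((nat \<Rightarrow> real) \<Rightarrow> 'a) set" where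
  "cell_classes A = (\<lambda>n\<in>{1..}. \<lambda>k\<in>{1..}. pi_class n ((SOME f. f \<in> A) \<circ> cell n k))"

lemma pi_class_eq_iff:
  "1 \<le> n \<Longrightarrow> f \<in> pi_maps n X x0 \<Longrightarrow> g \<in> pi_maps n X x0 \<Longrightarrow> pi_class n f = pi_class n g \<longleftrightarrow> pi_rel n X x0 f g"
  by (rule hclass_mult.hclass_eq_iff[OF hclass_mult_pi])

lemma cell_classes_Hinf_class:
  assumes f: "f \<in> Hinf_maps X x0"
  shows "cell_classes (Hinf_class f) = (\<lambda>n\<in>{1..}. \<lambda>k\<in>{1..}. pi_class n (f \<circ> cell n k))"
  unfolding cell_classes_def
proof (intro restrict_ext)
  fix n k :: nat assume "n \<in> {1..}" "k \<in> {1..}"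
  then have nk: "1 \<le> n" "1 \<le> k" by auto
  let ?g = "SOME g. g \<in> Hinf_class f"
  have g: "?g \<in> Hinf_maps X x0" "Hinf_rel X x0 f ?g"
    using hclass_mult.some_hclass[OF hclass_mult_Hinf f] by auto
  show "pi_class n (?g \<circ> cell n k) = pi_class n (f \<circ> cell n k)"
    using Hinf_rel_imp_pi_rel[OF g(2) nk] g(1) f nk
    by (simp add: pi_class_eq_iff Hinf_maps_comp_cell pi_rel_sym)
qed

lemma group_pi: "1 \<le> n \<Longrightarrow> group (pi_group n X x0)"
  using x0_in_topspace by (intro group_pi_group)

lemma carrier_pi_group: "carrier (pi_group n X x0) = pi_class n ` pi_maps n X x0"
  by (simp add: pi_group_def hclass_group_def)

lemma one_pi_group: "\<one>\<^bsub>pi_group n X x0\<^esub> = pi_class n (\<lambda>_. x0)"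
  by (simp add: pi_group_def hclass_group_def)

text \<open>Two nested finiteness conditions, finitely many nontrivial n and for each n finitely
  many nontrivial k, amount to finitely many pairs: the pairs lie in a finite sum of finite sets,
  and conversely both projections of a finite set are finite.\<close>

lemma carrier_weak_product:
  "x \<in> carrier weak_product \<longleftrightarrow>
     x \<in> (\<Pi>\<^sub>E n\<in>{1..}. \<Pi>\<^sub>E k\<in>{1..}. pi_class n ` pi_maps n X x0) \<and>
     finite {(n, k). 1 \<le> n \<and> 1 \<le> k \<and> x n k \<noteq> pi_class n (\<lambda>_. x0)}"
proof -
  let ?G = "\<lambda>n. sum_group {1::nat..} (\<lambda>k. pi_group n X x0)"
  let ?S = "\<lambda>n. {k \<in> {1..}. x n k \<noteq> pi_class n (\<lambda>_. x0)}"
  let ?B = "{(n, k). 1 \<le> n \<and> 1 \<le> k \<and> x n k \<noteq> pi_class n (\<lambda>_. x0)}"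
  have G: "carrier (?G n) = {y \<in> \<Pi>\<^sub>E k\<in>{1..}. pi_class n ` pi_maps n X x0.
      finite {k \<in> {1..}. y k \<noteq> pi_class n (\<lambda>_. x0)}}" if "1 \<le> n" for n
    using group_pi[OF that] by (subst carrier_sum_group) (simp_all add: carrier_pi_group one_pi_group)
  have x: "x \<in> carrier weak_product \<longleftrightarrow> x \<in> (\<Pi>\<^sub>E n\<in>{1..}. carrier (?G n)) \<and>
      finite {n \<in> {1..}. x n \<noteq> (\<lambda>k\<in>{1..}. pi_class n (\<lambda>_. x0))}"
    using group_pi by (subst carrier_sum_group) (simp_all add: one_pi_group)
  have ne: "{n \<in> {1..}. x n \<noteq> (\<lambda>k\<in>{1..}. pi_class n (\<lambda>_. x0))} = fst ` ?B"
    if "x \<in> (\<Pi>\<^sub>E n\<in>{1..}. \<Pi>\<^sub>E k\<in>{1..}. pi_class n ` pi_maps n X x0)"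
  proof -
    \<comment> \<open>The inner unit is a restricted function; equality with it can be tested on
      positive k because \<open>x n\<close> is extensional.\<close>
    have "x n \<noteq> (\<lambda>k\<in>{1..}. pi_class n (\<lambda>_. x0)) \<longleftrightarrow> (\<exists>k\<ge>1. x n k \<noteq> pi_class n (\<lambda>_. x0))"
      if "1 \<le> n" for n
    proof -
      have "x n \<in> extensional {1..}"
        using PiE_mem[OF \<open>x \<in> _\<close>, of n] that by (auto simp: PiE_def)
      then show ?thesis by (auto simp: fun_eq_iff extensional_def restrict_def)
    qed
    note iff = this
    show ?thesis
    proof (intro equalityI subsetI)
      fix n assume n: "n \<in> {n \<in> {1..}. x n \<noteq> (\<lambda>k\<in>{1..}. pi_class n (\<lambda>_. x0))}"
      with iff[of n] obtain k where "1 \<le> k" "x n k \<noteq> pi_class n (\<lambda>_. x0)" by auto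
      with n show "n \<in> fst ` ?B" by (intro image_eqI[of _ _ "(n, k)"]) simp_all
    next
      fix n assume "n \<in> fst ` ?B"
      then obtain q where "q \<in> ?B" "n = fst q" by (elim imageE)
      then have "1 \<le> n" "1 \<le> snd q" "x n (snd q) \<noteq> pi_class n (\<lambda>_. x0)"
        by (simp_all add: case_prod_beta)
      with iff[of n] show "n \<in> {n \<in> {1..}. x n \<noteq> (\<lambda>k\<in>{1..}. pi_class n (\<lambda>_. x0))}" by auto
    qed
  qed
  show ?thesis
  proof
    assume "x \<in> carrier weak_product"
    then have *: "x \<in> (\<Pi>\<^sub>E n\<in>{1..}. carrier (?G n))"
      and fin: "finite {n \<in> {1..}. x n \<noteq> (\<lambda>k\<in>{1..}. pi_class n (\<lambda>_. x0))}"
      using x by auto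
    then have **: "x \<in> (\<Pi>\<^sub>E n\<in>{1..}. \<Pi>\<^sub>E k\<in>{1..}. pi_class n ` pi_maps n X x0)"
      using G by (auto simp: PiE_iff)
    have "finite (?S n)" if "1 \<le> n" for n
      using PiE_mem[OF *, of n] G[OF that] that by auto
    moreover have "finite (fst ` ?B)" using fin ne[OF **] by simp
    ultimately have "finite (Sigma (fst ` ?B) ?S)" by (intro finite_SigmaI) auto
    then have "finite ?B" by (rule rev_finite_subset) force
    with ** show "x \<in> (\<Pi>\<^sub>E n\<in>{1..}. \<Pi>\<^sub>E k\<in>{1..}. pi_class n ` pi_maps n X x0) \<and> finite ?B"
      by blast
  next
    assume *: "x \<in> (\<Pi>\<^sub>E n\<in>{1..}. \<Pi>\<^sub>E k\<in>{1..}. pi_class n ` pi_maps n X x0) \<and> finite ?B"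
    have "finite (?S n)" if "1 \<le> n" for n
    proof (rule finite_subset)
      show "?S n \<subseteq> snd ` ?B" using that by force
    qed (use * in simp)
    then have "x \<in> (\<Pi>\<^sub>E n\<in>{1..}. carrier (?G n))"
      using * G by (auto simp: PiE_iff)
    moreover have "finite (fst ` ?B)" using * by simp
    ultimately show "x \<in> carrier weak_product"
      using x ne * by simp
  qed
qed

lemma cell_classes_in_carrier:
  assumes f: "f \<in> Hinf_maps X x0"
  shows "cell_classes (Hinf_class f) \<in> carrier weak_product"
  unfolding carrier_weak_product cell_classes_Hinf_class[OF f]
proof
  show "finite {(n, k). 1 \<le> n \<and> 1 \<le> k \<and>
      (\<lambda>n\<in>{1..}. \<lambda>k\<in>{1..}. pi_class n (f \<circ> cell n k)) n k \<noteq> pi_class n (\<lambda>_. x0)}"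
  proof (rule finite_subset[OF _ finite_nontrivial_cells[OF f]])
    have "pi_class n (f \<circ> cell n k) = pi_class n (\<lambda>_. x0) \<longleftrightarrow> pi_rel n X x0 (f \<circ> cell n k) (\<lambda>_. x0)"
      if "1 \<le> n" "1 \<le> k" for n k
      using that f x0_in_topspace by (intro pi_class_eq_iff Hinf_maps_comp_cell const_in_pi_maps)
    then show "{(n, k). 1 \<le> n \<and> 1 \<le> k \<and>
        (\<lambda>n\<in>{1..}. \<lambda>k\<in>{1..}. pi_class n (f \<circ> cell n k)) n k \<noteq> pi_class n (\<lambda>_. x0)}
      \<subseteq> {(n, k). 1 \<le> n \<and> 1 \<le> k \<and> \<not> pi_rel n X x0 (f \<circ> cell n k) (\<lambda>_. x0)}"
      by (simp add: subset_iff)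
  qed
qed (use f in \<open>auto intro!: imageI Hinf_maps_comp_cell\<close>)

text \<open>Injectivity is \<open>pi_rel_imp_Hinf_rel\<close>; surjectivity realizes a finitely
  supported family by a map that is constant on all other spheres.\<close>

lemma cell_classes_iso: "cell_classes \<in> iso (Hinf_group X x0) weak_product"
proof -
  have carrier: "carrier (Hinf_group X x0) = Hinf_class ` Hinf_maps X x0"
    by (simp add: Hinf_group_def hclass_group_def)
  have "cell_classes \<in> hom (Hinf_group X x0) weak_product"
  proof (rule homI)
    fix A B assume "A \<in> carrier (Hinf_group X x0)" "B \<in> carrier (Hinf_group X x0)"
    then obtain f g where f: "f \<in> Hinf_maps X x0" "A = Hinf_class f"
      and g: "g \<in> Hinf_maps X x0" "B = Hinf_class g"
      by (auto simp: carrier)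
    let ?fg = "Hinf_concat f g x0"
    have fg: "?fg \<in> Hinf_maps X x0" using x0_in_topspace f(1) g(1) by (rule Hinf_concat_in_Hinf_maps)
    have "A \<otimes>\<^bsub>Hinf_group X x0\<^esub> B = Hinf_class ?fg"
      unfolding f(2) g(2) Hinf_group_def
      using hclass_mult.mult_hclass_group[OF hclass_mult_Hinf f(1) g(1)] .
    moreover have "pi_class n (f \<circ> cell n k) \<otimes>\<^bsub>pi_group n X x0\<^esub> pi_class n (g \<circ> cell n k)
        = pi_class n (?fg \<circ> cell n k)" if nk: "1 \<le> n" "1 \<le> k" for n k
    proof -
      have m: "f \<circ> cell n k \<in> pi_maps n X x0" "g \<circ> cell n k \<in> pi_maps n X x0"
        using f g nk Hinf_maps_comp_cell by auto
      have "pi_class n (f \<circ> cell n k) \<otimes>\<^bsub>pi_group n X x0\<^esub> pi_class n (g \<circ> cell n k)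
          = pi_class n (cube_concat (f \<circ> cell n k) (g \<circ> cell n k))"
        unfolding pi_group_def by (rule hclass_mult.mult_hclass_group[OF hclass_mult_pi[OF nk(1)] m])
      also have "\<dots> = pi_class n (?fg \<circ> cell n k)"
        using pi_rel_sym[OF pi_rel_Hinf_concat_cell[OF x0_in_topspace f(1) g(1) nk]]
        by (simp only: pi_class_eq_iff[OF nk(1) pi_rel_imp_maps])
      finally show ?thesis .
    qed
    ultimately show "cell_classes (A \<otimes>\<^bsub>Hinf_group X x0\<^esub> B) =
        cell_classes A \<otimes>\<^bsub>weak_product\<^esub> cell_classes B"
      using f g fg by (auto simp: cell_classes_Hinf_class fun_eq_iff restrict_def)
  qed (auto simp: carrier cell_classes_in_carrier simp del: One_nat_def)
  moreover have "inj_on cell_classes (carrier (Hinf_group X x0))"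
  proof (rule inj_onI)
    fix A B assume "A \<in> carrier (Hinf_group X x0)" "B \<in> carrier (Hinf_group X x0)"
      and eq: "cell_classes A = cell_classes B"
    then obtain f g where f: "f \<in> Hinf_maps X x0" "A = Hinf_class f"
      and g: "g \<in> Hinf_maps X x0" "B = Hinf_class g"
      by (auto simp: carrier)
    have "pi_rel n X x0 (f \<circ> cell n k) (g \<circ> cell n k)" if nk: "1 \<le> n" "1 \<le> k" for n k
      using fun_cong[OF fun_cong[OF eq, of n], of k] nk f g
      by (simp add: cell_classes_Hinf_class pi_class_eq_iff Hinf_maps_comp_cell)
    then have "Hinf_rel X x0 f g" using f g pi_rel_imp_Hinf_rel by blast
    then show "A = B"
      using f g hclass_mult.hclass_eq_iff[OF hclass_mult_Hinf] by blast
  qed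
  moreover have "carrier weak_product \<subseteq> cell_classes ` carrier (Hinf_group X x0)"
  proof
    fix x assume "x \<in> carrier weak_product"
    then have x: "x \<in> (\<Pi>\<^sub>E n\<in>{1..}. \<Pi>\<^sub>E k\<in>{1..}. pi_class n ` pi_maps n X x0)"
      and fin: "finite {(n, k). 1 \<le> n \<and> 1 \<le> k \<and> x n k \<noteq> pi_class n (\<lambda>_. x0)}"
      by (simp_all only: carrier_weak_product)
    \<comment> \<open>Trivial classes are represented by the constant map itself: a merely
      null-homotopic representative may have a large image, and infinitely many of these could fail
      to glue continuously at \<open>theta\<close>.\<close>
    have ex: "\<exists>d. d \<in> pi_maps n X x0 \<and> pi_class n d = x n k \<and> (x n k = pi_class n (\<lambda>_. x0) \<longrightarrow> d = (\<lambda>_. x0))"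
      if "1 \<le> n" "1 \<le> k" for n k
    proof (cases "x n k = pi_class n (\<lambda>_. x0)")
      case False
      moreover have "x n k \<in> pi_class n ` pi_maps n X x0"
        using PiE_mem[OF PiE_mem[OF x, of n], of k] that by simp
      ultimately show ?thesis by force
    qed (use const_in_pi_maps x0_in_topspace in auto)
    define d where "d n k = (SOME d. d \<in> pi_maps n X x0 \<and> pi_class n d = x n k \<and>
        (x n k = pi_class n (\<lambda>_. x0) \<longrightarrow> d = (\<lambda>_. x0)))" for n k
    have d_props: "d n k \<in> pi_maps n X x0 \<and> pi_class n (d n k) = x n k \<and>
        (x n k = pi_class n (\<lambda>_. x0) \<longrightarrow> d n k = (\<lambda>_. x0))" if "1 \<le> n" "1 \<le> k" for n k
      unfolding d_def using ex[OF that] by (rule someI_ex)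
    then have d: "\<And>n k. \<lbrakk>1 \<le> n; 1 \<le> k\<rbrakk> \<Longrightarrow> d n k \<in> pi_maps n X x0"
      "\<And>n k. \<lbrakk>1 \<le> n; 1 \<le> k\<rbrakk> \<Longrightarrow> pi_class n (d n k) = x n k"
      "\<And>n k. \<lbrakk>1 \<le> n; 1 \<le> k; x n k = pi_class n (\<lambda>_. x0)\<rbrakk> \<Longrightarrow> d n k = (\<lambda>_. x0)"
      by simp_all
    have "finite {(n, k). 1 \<le> n \<and> 1 \<le> k \<and> \<not> d n k ` cube_set n \<subseteq> U}" if "openin X U" "x0 \<in> U" for U
      using fin by (rule rev_finite_subset) (use d(3) that in auto)
    then obtain f where f: "f \<in> Hinf_maps X x0"
      "\<And>n k s. 1 \<le> n \<Longrightarrow> 1 \<le> k \<Longrightarrow> s \<in> cube_set n \<Longrightarrow> f (cell n k s) = d n k s"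
      using exists_Hinf_map[where c = d, OF x0_in_topspace d(1)] by blast
    have "pi_class n (f \<circ> cell n k) = x n k" if nk: "1 \<le> n" "1 \<le> k" for n k
    proof -
      have "pi_rel n X x0 (f \<circ> cell n k) (d n k)"
        using f nk by (intro pi_rel_equal Hinf_maps_comp_cell) auto
      then have "pi_class n (f \<circ> cell n k) = pi_class n (d n k)"
        using d(1)[OF nk] Hinf_maps_comp_cell[OF f(1) nk] nk by (simp add: pi_class_eq_iff)
      with d(2)[OF nk] show ?thesis by simp
    qed
    then have "cell_classes (Hinf_class f) = (\<lambda>n\<in>{1..}. \<lambda>k\<in>{1..}. x n k)"
      unfolding cell_classes_Hinf_class[OF f(1)] by (intro restrict_ext) simp
    also have "\<dots> = x"
    proof -
      have "(\<lambda>k\<in>{1..}. x n k) = x n" if "n \<in> {1..}" for n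
        using PiE_mem[OF x that] by (rule PiE_restrict)
      then have "(\<lambda>n\<in>{1..}. \<lambda>k\<in>{1..}. x n k) = restrict x {1..}"
        by (intro restrict_ext)
      then show ?thesis using x by (simp add: PiE_restrict)
    qed
    finally show "x \<in> cell_classes ` carrier (Hinf_group X x0)"
      using f(1) carrier by blast
  qed
  ultimately show ?thesis
    by (auto simp: iso_def bij_betw_def hom_def)
qed

end

theorem theorem3p1:
  fixes X :: "'a topology" and x0 :: 'a
  assumes "x0 \<in> topspace X"
    and "first_countable_at X x0"
    and "locally_strongly_contractible_at X x0"
  shows "Hinf_group X x0 \<cong>
           sum_group {1..} (\<lambda>n::nat. sum_group {1::nat..} (\<lambda>k. pi_group n X x0))"
proof -
  \<comment> \<open>Strong contractibility is applied with U the whole space; control near x_0 is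
    supplied by \<open>contraction_tube\<close>.\<close>
  obtain V where V: "openin X V" "x0 \<in> V"
    and hom: "homotopic_with (\<lambda>h. h x0 = x0) (subtopology X V) (subtopology X (topspace X)) id (\<lambda>_. x0)"
    using assms(1,3) unfolding locally_strongly_contractible_at_def by blast
  from hom obtain c where "continuous_map (prod_topology unit_interval (subtopology X V)) X c"
    "\<And>x. c (0, x) = x" "\<And>x. c (1, x) = x0" "\<And>t. t \<in> {0..1} \<Longrightarrow> c (t, x0) = x0"
    unfolding homotopic_with_def by auto
  with V interpret contracting_nbhd X x0 V c
    by unfold_locales
  show ?thesis using cell_classes_iso by (auto simp: is_iso_def)
qed

end
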